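(* Let $F\colon\mathcal{A}\to\mathcal{B}$ be an additive functor between two Frobenius exact categories. Then $F$ is a Frobenius quotient if and only if $F$ is a pretriangle-equivalence, objective, full and dense.
   Context: **Exact and Frobenius categories.** An exact category (Quillen) is an additive category $\mathcal{A}$ with an exact structure $\mathcal{E}$, i.e. a class of kernel-cokernel pairs $(i,p)$ called conflations ($i$ is an inflation, $p$ a deflation) satisfying the usual axioms. It is Frobenius if it has enough projectives and enough injectives and these two classes coincide; $\mathcal{P}$ denotes the full subcategory of projective-injectives. For an additive subcategory $\mathcal{X}\subseteq\mathcal{A}$, $[\mathcal{X}]$ is the ideal of morphisms factoring through objects of $\mathcal{X}$, and $\mathcal{A}/[\mathcal{X}]$ is the factor category. The stable category of a Frobenius category is $\underline{\mathcal{A}}=\mathcal{A}/[\mathcal{P}]$, with its canonical triangulated structure. A functor between exact categories is exact if it is additive and sends conflations to conflations; an exact equivalence is an exact functor which is an equivalence and has an exact quasi-inverse. **Frobenius quotients.** Let $(\mathcal{A},\mathcal{E})$ be a Frobenius category. A full additive subcategory $\mathcal{F}\subseteq\mathcal{A}$ is removable if $\mathcal{F}\subseteq\mathcal{P}$ and the canonical functor $\pi_{\mathcal{F}}\colon\mathcal{A}\to\mathcal{A}/[\mathcal{F}]$ sends every conflation to a kernel-cokernel pair. In that case $\mathcal{A}/[\mathcal{F}]$ is a Frobenius category with exact structure the closure under isomorphism of $\pi_{\mathcal{F}}(\mathcal{E})$, its projectives are $\mathcal{P}/[\mathcal{F}]$, and $\pi_{\mathcal{F}}$ is a pretriangle-equivalence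 (known facts). An additive functor $F\colon\mathcal{A}\to\mathcal{B}$ between Frobenius categories is a Frobenius quotient if $F=\bar F\circ\pi_{\mathcal{F}}$ for some removable $\mathcal{F}\subseteq\mathcal{A}$ and some exact equivalence $\bar F\colon\mathcal{A}/[\mathcal{F}]\to\mathcal{B}$. **Other notions.** A pretriangle-equivalence between Frobenius categories is an exact functor $F\colon\mathcal{A}\to\mathcal{B}$ which sends projectives to projectives and whose induced triangle functor $\underline{\mathcal{A}}\to\underline{\mathcal{B}}$ is an equivalence. The essential kernel ${\rm Ker}(F)$ is the full subcategory of objects annihilated by $F$. An additive functor $F$ is objective if each morphism $f$ with $F(f)=0$ factors through an object of ${\rm Ker}(F)$. Dense means essentially surjective. *)

theory Defs
  imports "HOL-Algebra.Group"
begin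

section \<open>Additive categories\<close>

text \<open>
  Categories are given by a set of objects and hom-sets that are pairwise disjoint, so that a
  morphism determines its source and target and neither composition nor addition needs objects as
  arguments. \<open>g \<cdot> f\<close> is \<open>g\<close> after \<open>f\<close>; \<open>f \<boxplus> g\<close> is the sum of parallel morphisms. The operations
  are only meaningful on composable, respectively parallel, morphisms.
\<close>

record ('o, 'm) cat =
  Ob :: "'o set"
  Hom :: "'o \<Rightarrow> 'o \<Rightarrow> 'm set"
  Comp :: "'m \<Rightarrow> 'm \<Rightarrow> 'm"  (infixl "\<cdot>\<index>" 70)
  Id :: "'o \<Rightarrow> 'm"
  Add :: "'m \<Rightarrow> 'm \<Rightarrow> 'm"  (infixl "\<boxplus>\<index>" 65)
  Zero :: "'o \<Rightarrow> 'o \<Rightarrow> 'm"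

definition hom_group :: "('o, 'm) cat \<Rightarrow> 'o \<Rightarrow> 'o \<Rightarrow> 'm monoid" where
  "hom_group C X Y = \<lparr>carrier = Hom C X Y, mult = Add C, one = Zero C X Y\<rparr>"

locale preadditive_category =
  fixes C :: "('o, 'm) cat" (structure)
  assumes Hom_Ob: "f \<in> Hom C X Y \<Longrightarrow> X \<in> Ob C \<and> Y \<in> Ob C"
    and Hom_disjoint: "f \<in> Hom C X Y \<Longrightarrow> f \<in> Hom C X' Y' \<Longrightarrow> X = X' \<and> Y = Y'"
    and Id_Hom: "X \<in> Ob C \<Longrightarrow> Id C X \<in> Hom C X X"
    and Comp_Hom: "f \<in> Hom C X Y \<Longrightarrow> g \<in> Hom C Y Z \<Longrightarrow> g \<cdot> f \<in> Hom C X Z"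
    and Comp_Id: "f \<in> Hom C X Y \<Longrightarrow> f \<cdot> Id C X = f"
    and Id_Comp: "f \<in> Hom C X Y \<Longrightarrow> Id C Y \<cdot> f = f"
    and Comp_assoc: "f \<in> Hom C W X \<Longrightarrow> g \<in> Hom C X Y \<Longrightarrow> h \<in> Hom C Y Z \<Longrightarrow>
      h \<cdot> (g \<cdot> f) = (h \<cdot> g) \<cdot> f"
    and Hom_comm_group: "X \<in> Ob C \<Longrightarrow> Y \<in> Ob C \<Longrightarrow> comm_group (hom_group C X Y)"
    and Comp_Add: "f \<in> Hom C X Y \<Longrightarrow> f' \<in> Hom C X Y \<Longrightarrow> g \<in> Hom C Y Z \<Longrightarrow>
      g \<cdot> (f \<boxplus> f') = (g \<cdot> f) \<boxplus> (g \<cdot> f')"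
    and Add_Comp: "f \<in> Hom C X Y \<Longrightarrow> g \<in> Hom C Y Z \<Longrightarrow> g' \<in> Hom C Y Z \<Longrightarrow>
      (g \<boxplus> g') \<cdot> f = (g \<cdot> f) \<boxplus> (g' \<cdot> f)"

definition zero_object :: "('o, 'm) cat \<Rightarrow> 'o \<Rightarrow> bool" where
  "zero_object C Z \<longleftrightarrow> Z \<in> Ob C \<and>
     (\<forall>X\<in>Ob C. (\<exists>!f. f \<in> Hom C X Z) \<and> (\<exists>!f. f \<in> Hom C Z X))"

definition biproduct :: "('o, 'm) cat \<Rightarrow> 'o \<Rightarrow> 'o \<Rightarrow> 'o \<Rightarrow> bool" where
  "biproduct C X Y S \<longleftrightarrow>
     (\<exists>i \<in> Hom C X S. \<exists>j \<in> Hom C Y S. \<exists>p \<in> Hom C S X. \<exists>q \<in> Hom C S Y.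
        p \<cdot>\<^bsub>C\<^esub> i = Id C X \<and> q \<cdot>\<^bsub>C\<^esub> j = Id C Y \<and>
        p \<cdot>\<^bsub>C\<^esub> j = Zero C Y X \<and> q \<cdot>\<^bsub>C\<^esub> i = Zero C X Y \<and>
        (i \<cdot>\<^bsub>C\<^esub> p) \<boxplus>\<^bsub>C\<^esub> (j \<cdot>\<^bsub>C\<^esub> q) = Id C S)"

locale additive_category = preadditive_category +
  assumes ex_zero_object: "\<exists>Z. zero_object C Z"
    and ex_biproduct: "X \<in> Ob C \<Longrightarrow> Y \<in> Ob C \<Longrightarrow> \<exists>S. biproduct C X Y S"

definition is_iso :: "('o, 'm) cat \<Rightarrow> 'o \<Rightarrow> 'o \<Rightarrow> 'm \<Rightarrow> bool" where
  "is_iso C X Y f \<longleftrightarrow> f \<in> Hom C X Y \<and>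
     (\<exists>g \<in> Hom C Y X. g \<cdot>\<^bsub>C\<^esub> f = Id C X \<and> f \<cdot>\<^bsub>C\<^esub> g = Id C Y)"

definition isomorphic :: "('o, 'm) cat \<Rightarrow> 'o \<Rightarrow> 'o \<Rightarrow> bool" where
  "isomorphic C X Y \<longleftrightarrow> (\<exists>f. is_iso C X Y f)"

section \<open>Exact and Frobenius categories\<close>

definition is_kernel :: "('o, 'm) cat \<Rightarrow> 'o \<Rightarrow> 'o \<Rightarrow> 'o \<Rightarrow> 'm \<Rightarrow> 'm \<Rightarrow> bool" where
  "is_kernel C X Y Z i p \<longleftrightarrow> i \<in> Hom C X Y \<and> p \<in> Hom C Y Z \<and> p \<cdot>\<^bsub>C\<^esub> i = Zero C X Z \<and>
     (\<forall>W. \<forall>f \<in> Hom C W Y. p \<cdot>\<^bsub>C\<^esub> f = Zero C W Z \<longrightarrow> (\<exists>!g. g \<in> Hom C W X \<and> i \<cdot>\<^bsub>C\<^esub> g = f))"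

definition is_cokernel :: "('o, 'm) cat \<Rightarrow> 'o \<Rightarrow> 'o \<Rightarrow> 'o \<Rightarrow> 'm \<Rightarrow> 'm \<Rightarrow> bool" where
  "is_cokernel C X Y Z i p \<longleftrightarrow> i \<in> Hom C X Y \<and> p \<in> Hom C Y Z \<and> p \<cdot>\<^bsub>C\<^esub> i = Zero C X Z \<and>
     (\<forall>W. \<forall>f \<in> Hom C Y W. f \<cdot>\<^bsub>C\<^esub> i = Zero C X W \<longrightarrow> (\<exists>!g. g \<in> Hom C Z W \<and> g \<cdot>\<^bsub>C\<^esub> p = f))"

definition kernel_cokernel_pair :: "('o, 'm) cat \<Rightarrow> 'm \<times> 'm \<Rightarrow> bool" where
  "kernel_cokernel_pair C = (\<lambda>(i, p). \<exists>X Y Z. is_kernel C X Y Z i p \<and> is_cokernel C X Y Z i p)"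

definition iso_pairs :: "('o, 'm) cat \<Rightarrow> 'm \<times> 'm \<Rightarrow> 'm \<times> 'm \<Rightarrow> bool" where
  "iso_pairs C = (\<lambda>(i, p) (i', p'). \<exists>X Y Z X' Y' Z' a b c.
     i \<in> Hom C X Y \<and> p \<in> Hom C Y Z \<and> i' \<in> Hom C X' Y' \<and> p' \<in> Hom C Y' Z' \<and>
     is_iso C X X' a \<and> is_iso C Y Y' b \<and> is_iso C Z Z' c \<and>
     b \<cdot>\<^bsub>C\<^esub> i = i' \<cdot>\<^bsub>C\<^esub> a \<and> c \<cdot>\<^bsub>C\<^esub> p = p' \<cdot>\<^bsub>C\<^esub> b)"

definition inflation :: "('m \<times> 'm) set \<Rightarrow> 'm \<Rightarrow> bool" where
  "inflation E i \<longleftrightarrow> (\<exists>p. (i, p) \<in> E)"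

definition deflation :: "('m \<times> 'm) set \<Rightarrow> 'm \<Rightarrow> bool" where
  "deflation E p \<longleftrightarrow> (\<exists>i. (i, p) \<in> E)"

text \<open>
  The square with \<open>i : X \<rightarrow> Y\<close>, \<open>f : X \<rightarrow> X'\<close>, \<open>i' : X' \<rightarrow> Y'\<close>, \<open>f' : Y \<rightarrow> Y'\<close> is a pushout.
\<close>

definition is_pushout ::
  "('o, 'm) cat \<Rightarrow> 'o \<Rightarrow> 'o \<Rightarrow> 'o \<Rightarrow> 'o \<Rightarrow> 'm \<Rightarrow> 'm \<Rightarrow> 'm \<Rightarrow> 'm \<Rightarrow> bool" where
  "is_pushout C X Y X' Y' i f i' f' \<longleftrightarrow>
     i \<in> Hom C X Y \<and> f \<in> Hom C X X' \<and> i' \<in> Hom C X' Y' \<and> f' \<in> Hom C Y Y' \<and>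
     f' \<cdot>\<^bsub>C\<^esub> i = i' \<cdot>\<^bsub>C\<^esub> f \<and>
     (\<forall>W. \<forall>u \<in> Hom C Y W. \<forall>v \<in> Hom C X' W. u \<cdot>\<^bsub>C\<^esub> i = v \<cdot>\<^bsub>C\<^esub> f \<longrightarrow>
        (\<exists>!w. w \<in> Hom C Y' W \<and> w \<cdot>\<^bsub>C\<^esub> f' = u \<and> w \<cdot>\<^bsub>C\<^esub> i' = v))"

text \<open>
  The square with \<open>p' : Y' \<rightarrow> Z'\<close>, \<open>f' : Y' \<rightarrow> Y\<close>, \<open>p : Y \<rightarrow> Z\<close>, \<open>f : Z' \<rightarrow> Z\<close> is a pullback.
\<close>

definition is_pullback ::
  "('o, 'm) cat \<Rightarrow> 'o \<Rightarrow> 'o \<Rightarrow> 'o \<Rightarrow> 'o \<Rightarrow> 'm \<Rightarrow> 'm \<Rightarrow> 'm \<Rightarrow> 'm \<Rightarrow> bool" where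
  "is_pullback C Y Z Y' Z' p f p' f' \<longleftrightarrow>
     p \<in> Hom C Y Z \<and> f \<in> Hom C Z' Z \<and> p' \<in> Hom C Y' Z' \<and> f' \<in> Hom C Y' Y \<and>
     p \<cdot>\<^bsub>C\<^esub> f' = f \<cdot>\<^bsub>C\<^esub> p' \<and>
     (\<forall>W. \<forall>u \<in> Hom C W Y. \<forall>v \<in> Hom C W Z'. p \<cdot>\<^bsub>C\<^esub> u = f \<cdot>\<^bsub>C\<^esub> v \<longrightarrow>
        (\<exists>!w. w \<in> Hom C W Y' \<and> f' \<cdot>\<^bsub>C\<^esub> w = u \<and> p' \<cdot>\<^bsub>C\<^esub> w = v))"

text \<open>Quillen's axioms in the self-dual form of Buehler's survey; \<open>E\<close> is the class of conflations.\<close>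

locale exact_category = additive_category C
  for C :: "('o, 'm) cat" (structure) +
  fixes E :: "('m \<times> 'm) set"
  assumes conflation_pair: "e \<in> E \<Longrightarrow> kernel_cokernel_pair C e"
    and conflation_iso: "e \<in> E \<Longrightarrow> iso_pairs C e e' \<Longrightarrow> e' \<in> E"
    and inflation_Id: "X \<in> Ob C \<Longrightarrow> inflation E (Id C X)"
    and deflation_Id: "X \<in> Ob C \<Longrightarrow> deflation E (Id C X)"
    and inflation_Comp: "f \<in> Hom C X Y \<Longrightarrow> g \<in> Hom C Y Z \<Longrightarrow>
      inflation E f \<Longrightarrow> inflation E g \<Longrightarrow> inflation E (g \<cdot> f)"
    and deflation_Comp: "f \<in> Hom C X Y \<Longrightarrow> g \<in> Hom C Y Z \<Longrightarrow>
      deflation E f \<Longrightarrow> deflation E g \<Longrightarrow> deflation E (g \<cdot> f)"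
    and inflation_pushout: "i \<in> Hom C X Y \<Longrightarrow> inflation E i \<Longrightarrow> f \<in> Hom C X X' \<Longrightarrow>
      \<exists>Y' i' f'. is_pushout C X Y X' Y' i f i' f' \<and> inflation E i'"
    and deflation_pullback: "p \<in> Hom C Y Z \<Longrightarrow> deflation E p \<Longrightarrow> f \<in> Hom C Z' Z \<Longrightarrow>
      \<exists>Y' p' f'. is_pullback C Y Z Y' Z' p f p' f' \<and> deflation E p'"

definition projectives :: "('o, 'm) cat \<Rightarrow> ('m \<times> 'm) set \<Rightarrow> 'o set" where
  "projectives C E = {P \<in> Ob C. \<forall>Y Z. \<forall>p \<in> Hom C Y Z. deflation E p \<longrightarrow>
     (\<forall>f \<in> Hom C P Z. \<exists>g \<in> Hom C P Y. p \<cdot>\<^bsub>C\<^esub> g = f)}"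

definition injectives :: "('o, 'm) cat \<Rightarrow> ('m \<times> 'm) set \<Rightarrow> 'o set" where
  "injectives C E = {I \<in> Ob C. \<forall>X Y. \<forall>i \<in> Hom C X Y. inflation E i \<longrightarrow>
     (\<forall>f \<in> Hom C X I. \<exists>g \<in> Hom C Y I. g \<cdot>\<^bsub>C\<^esub> i = f)}"

locale frobenius_category = exact_category +
  assumes enough_projectives:
      "X \<in> Ob C \<Longrightarrow> \<exists>P \<in> projectives C E. \<exists>p \<in> Hom C P X. deflation E p"
    and enough_injectives:
      "X \<in> Ob C \<Longrightarrow> \<exists>I \<in> injectives C E. \<exists>i \<in> Hom C X I. inflation E i"
    and projectives_eq_injectives: "projectives C E = injectives C E"

section \<open>Functors\<close>

record ('o1, 'm1, 'o2, 'm2) func =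
  fob :: "'o1 \<Rightarrow> 'o2"
  fhom :: "'m1 \<Rightarrow> 'm2"

definition is_functor ::
  "('o1, 'm1) cat \<Rightarrow> ('o2, 'm2) cat \<Rightarrow> ('o1, 'm1, 'o2, 'm2) func \<Rightarrow> bool" where
  "is_functor A B F \<longleftrightarrow>
     (\<forall>X \<in> Ob A. fob F X \<in> Ob B) \<and>
     (\<forall>X Y. \<forall>f \<in> Hom A X Y. fhom F f \<in> Hom B (fob F X) (fob F Y)) \<and>
     (\<forall>X \<in> Ob A. fhom F (Id A X) = Id B (fob F X)) \<and>
     (\<forall>X Y Z. \<forall>f \<in> Hom A X Y. \<forall>g \<in> Hom A Y Z. fhom F (g \<cdot>\<^bsub>A\<^esub> f) = fhom F g \<cdot>\<^bsub>B\<^esub> fhom F f)"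

definition additive_functor ::
  "('o1, 'm1) cat \<Rightarrow> ('o2, 'm2) cat \<Rightarrow> ('o1, 'm1, 'o2, 'm2) func \<Rightarrow> bool" where
  "additive_functor A B F \<longleftrightarrow> is_functor A B F \<and>
     (\<forall>X Y. \<forall>f \<in> Hom A X Y. \<forall>g \<in> Hom A X Y. fhom F (f \<boxplus>\<^bsub>A\<^esub> g) = fhom F f \<boxplus>\<^bsub>B\<^esub> fhom F g)"

definition id_functor :: "('o, 'm, 'o, 'm) func" where
  "id_functor = \<lparr>fob = (\<lambda>X. X), fhom = (\<lambda>f. f)\<rparr>"

definition comp_functor ::
  "('o2, 'm2, 'o3, 'm3) func \<Rightarrow> ('o1, 'm1, 'o2, 'm2) func \<Rightarrow> ('o1, 'm1, 'o3, 'm3) func" where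
  "comp_functor G F = \<lparr>fob = fob G \<circ> fob F, fhom = fhom G \<circ> fhom F\<rparr>"

text \<open>Equality of functors with source \<open>A\<close>, disregarding values outside of \<open>A\<close>.\<close>

definition functor_eq ::
  "('o1, 'm1) cat \<Rightarrow> ('o1, 'm1, 'o2, 'm2) func \<Rightarrow> ('o1, 'm1, 'o2, 'm2) func \<Rightarrow> bool" where
  "functor_eq A F G \<longleftrightarrow> (\<forall>X \<in> Ob A. fob F X = fob G X) \<and>
     (\<forall>X Y. \<forall>f \<in> Hom A X Y. fhom F f = fhom G f)"

definition naturally_isomorphic ::
  "('o1, 'm1) cat \<Rightarrow> ('o2, 'm2) cat \<Rightarrow>
   ('o1, 'm1, 'o2, 'm2) func \<Rightarrow> ('o1, 'm1, 'o2, 'm2) func \<Rightarrow> bool" where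
  "naturally_isomorphic A B F G \<longleftrightarrow> (\<exists>\<eta>. (\<forall>X \<in> Ob A. is_iso B (fob F X) (fob G X) (\<eta> X)) \<and>
     (\<forall>X Y. \<forall>f \<in> Hom A X Y. \<eta> Y \<cdot>\<^bsub>B\<^esub> fhom F f = fhom G f \<cdot>\<^bsub>B\<^esub> \<eta> X))"

definition quasi_inverse ::
  "('o1, 'm1) cat \<Rightarrow> ('o2, 'm2) cat \<Rightarrow>
   ('o1, 'm1, 'o2, 'm2) func \<Rightarrow> ('o2, 'm2, 'o1, 'm1) func \<Rightarrow> bool" where
  "quasi_inverse A B F G \<longleftrightarrow> is_functor A B F \<and> is_functor B A G \<and>
     naturally_isomorphic A A (comp_functor G F) id_functor \<and>
     naturally_isomorphic B B (comp_functor F G) id_functor"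

definition equivalence ::
  "('o1, 'm1) cat \<Rightarrow> ('o2, 'm2) cat \<Rightarrow> ('o1, 'm1, 'o2, 'm2) func \<Rightarrow> bool" where
  "equivalence A B F \<longleftrightarrow> (\<exists>G. quasi_inverse A B F G)"

definition full_functor ::
  "('o1, 'm1) cat \<Rightarrow> ('o2, 'm2) cat \<Rightarrow> ('o1, 'm1, 'o2, 'm2) func \<Rightarrow> bool" where
  "full_functor A B F \<longleftrightarrow>
     (\<forall>X \<in> Ob A. \<forall>Y \<in> Ob A. \<forall>g \<in> Hom B (fob F X) (fob F Y). \<exists>f \<in> Hom A X Y. fhom F f = g)"

definition dense_functor ::
  "('o1, 'm1) cat \<Rightarrow> ('o2, 'm2) cat \<Rightarrow> ('o1, 'm1, 'o2, 'm2) func \<Rightarrow> bool" where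
  "dense_functor A B F \<longleftrightarrow> (\<forall>Y \<in> Ob B. \<exists>X \<in> Ob A. isomorphic B (fob F X) Y)"

definition exact_functor ::
  "('o1, 'm1) cat \<Rightarrow> ('m1 \<times> 'm1) set \<Rightarrow> ('o2, 'm2) cat \<Rightarrow> ('m2 \<times> 'm2) set \<Rightarrow>
   ('o1, 'm1, 'o2, 'm2) func \<Rightarrow> bool" where
  "exact_functor A EA B EB F \<longleftrightarrow> additive_functor A B F \<and>
     (\<forall>(i, p) \<in> EA. (fhom F i, fhom F p) \<in> EB)"

definition exact_equivalence ::
  "('o1, 'm1) cat \<Rightarrow> ('m1 \<times> 'm1) set \<Rightarrow> ('o2, 'm2) cat \<Rightarrow> ('m2 \<times> 'm2) set \<Rightarrow>
   ('o1, 'm1, 'o2, 'm2) func \<Rightarrow> bool" where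
  "exact_equivalence A EA B EB F \<longleftrightarrow> exact_functor A EA B EB F \<and>
     (\<exists>G. exact_functor B EB A EA G \<and> quasi_inverse A B F G)"

section \<open>Factor categories\<close>

text \<open>
  Full subcategories are represented by their sets of objects. They are not assumed to be closed
  under isomorphisms.
\<close>

definition full_additive_subcategory :: "('o, 'm) cat \<Rightarrow> 'o set \<Rightarrow> bool" where
  "full_additive_subcategory C S \<longleftrightarrow> S \<subseteq> Ob C \<and> (\<exists>Z \<in> S. zero_object C Z) \<and>
     (\<forall>X \<in> S. \<forall>Y \<in> S. \<exists>W \<in> S. biproduct C X Y W)"

definition factor_ideal :: "('o, 'm) cat \<Rightarrow> 'o set \<Rightarrow> 'o \<Rightarrow> 'o \<Rightarrow> 'm set" where
  "factor_ideal C S X Y = {g \<cdot>\<^bsub>C\<^esub> f | f g. \<exists>Z \<in> S. f \<in> Hom C X Z \<and> g \<in> Hom C Z Y}"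

text \<open>The coset of \<open>f : X \<rightarrow> Y\<close> modulo \<open>[S](X, Y)\<close>; here \<open>X\<close> and \<open>Y\<close> are determined by \<open>f\<close>.\<close>

definition factor_class :: "('o, 'm) cat \<Rightarrow> 'o set \<Rightarrow> 'm \<Rightarrow> 'm set" where
  "factor_class C S f = {f \<boxplus>\<^bsub>C\<^esub> d | d. \<exists>X Y. f \<in> Hom C X Y \<and> d \<in> factor_ideal C S X Y}"

text \<open>
  The operations on cosets are induced by those on representatives: whenever \<open>[S]\<close> is an ideal, all
  members of the unions below coincide.
\<close>

definition factor_category :: "('o, 'm) cat \<Rightarrow> 'o set \<Rightarrow> ('o, 'm set) cat" where
  "factor_category C S =
    \<lparr>Ob = Ob C,
     Hom = (\<lambda>X Y. factor_class C S ` Hom C X Y),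
     Comp = (\<lambda>T U. \<Union>g \<in> T. \<Union>f \<in> U. factor_class C S (g \<cdot>\<^bsub>C\<^esub> f)),
     Id = (\<lambda>X. factor_class C S (Id C X)),
     Add = (\<lambda>T U. \<Union>f \<in> T. \<Union>g \<in> U. factor_class C S (f \<boxplus>\<^bsub>C\<^esub> g)),
     Zero = (\<lambda>X Y. factor_class C S (Zero C X Y))\<rparr>"

definition factor_functor :: "('o, 'm) cat \<Rightarrow> 'o set \<Rightarrow> ('o, 'm, 'o, 'm set) func" where
  "factor_functor C S = \<lparr>fob = (\<lambda>X. X), fhom = factor_class C S\<rparr>"

definition stable_category :: "('o, 'm) cat \<Rightarrow> ('m \<times> 'm) set \<Rightarrow> ('o, 'm set) cat" where
  "stable_category C E = factor_category C (projectives C E)"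

text \<open>
  The functor between stable categories induced by a functor that preserves projectives; again all
  members of the union coincide.
\<close>

definition stable_functor ::
  "('o2, 'm2) cat \<Rightarrow> ('m2 \<times> 'm2) set \<Rightarrow> ('o1, 'm1, 'o2, 'm2) func \<Rightarrow>
   ('o1, 'm1 set, 'o2, 'm2 set) func" where
  "stable_functor B EB F =
    \<lparr>fob = fob F, fhom = (\<lambda>T. \<Union>f \<in> T. factor_class B (projectives B EB) (fhom F f))\<rparr>"

section \<open>Frobenius quotients and pretriangle-equivalences\<close>

definition removable :: "('o, 'm) cat \<Rightarrow> ('m \<times> 'm) set \<Rightarrow> 'o set \<Rightarrow> bool" where
  "removable A E S \<longleftrightarrow> full_additive_subcategory A S \<and> S \<subseteq> projectives A E \<and>
     (\<forall>(i, p) \<in> E. kernel_cokernel_pair (factor_category A S)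
        (fhom (factor_functor A S) i, fhom (factor_functor A S) p))"

definition factor_conflations ::
  "('o, 'm) cat \<Rightarrow> ('m \<times> 'm) set \<Rightarrow> 'o set \<Rightarrow> ('m set \<times> 'm set) set" where
  "factor_conflations A E S = {e. \<exists>(i, p) \<in> E. iso_pairs (factor_category A S)
     (fhom (factor_functor A S) i, fhom (factor_functor A S) p) e}"

definition frobenius_quotient ::
  "('o1, 'm1) cat \<Rightarrow> ('m1 \<times> 'm1) set \<Rightarrow> ('o2, 'm2) cat \<Rightarrow> ('m2 \<times> 'm2) set \<Rightarrow>
   ('o1, 'm1, 'o2, 'm2) func \<Rightarrow> bool" where
  "frobenius_quotient A EA B EB F \<longleftrightarrow> additive_functor A B F \<and>
     (\<exists>S F'. removable A EA S \<and>
        exact_equivalence (factor_category A S) (factor_conflations A EA S) B EB F' \<and>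
        functor_eq A F (comp_functor F' (factor_functor A S)))"

text \<open>
  A triangle functor is an equivalence iff its underlying functor is one, so the canonical
  triangulations of the stable categories do not enter the definition.
\<close>

definition pretriangle_equivalence ::
  "('o1, 'm1) cat \<Rightarrow> ('m1 \<times> 'm1) set \<Rightarrow> ('o2, 'm2) cat \<Rightarrow> ('m2 \<times> 'm2) set \<Rightarrow>
   ('o1, 'm1, 'o2, 'm2) func \<Rightarrow> bool" where
  "pretriangle_equivalence A EA B EB F \<longleftrightarrow> exact_functor A EA B EB F \<and>
     (\<forall>P \<in> projectives A EA. fob F P \<in> projectives B EB) \<and>
     equivalence (stable_category A EA) (stable_category B EB) (stable_functor B EB F)"

definition essential_kernel ::
  "('o1, 'm1) cat \<Rightarrow> ('o2, 'm2) cat \<Rightarrow> ('o1, 'm1, 'o2, 'm2) func \<Rightarrow> 'o1 set" where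
  "essential_kernel A B F = {X \<in> Ob A. zero_object B (fob F X)}"

definition objective ::
  "('o1, 'm1) cat \<Rightarrow> ('o2, 'm2) cat \<Rightarrow> ('o1, 'm1, 'o2, 'm2) func \<Rightarrow> bool" where
  "objective A B F \<longleftrightarrow> (\<forall>X Y. \<forall>f \<in> Hom A X Y. fhom F f = Zero B (fob F X) (fob F Y) \<longrightarrow>
     f \<in> factor_ideal A (essential_kernel A B F) X Y)"

end

theory Submission
  imports Defs
begin

text \<open>
  Both directions turn on the comparison of \<open>F\<close> with the functor \<open>F'\<close> it induces on a factor category.
  If \<open>F\<close> is objective, full and dense, then modulo its essential kernel \<open>S\<close> it becomes an
  equivalence \<open>F'\<close>. Objects of \<open>S\<close> vanish in the stable category of \<open>B\<close>, hence in that of \<open>A\<close>, so they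
  are projective; and \<open>F'\<close> reflects kernel-cokernel pairs, so \<open>S\<close> is removable. What remains is that every
  conflation \<open>X \<rightarrow> Y \<rightarrow> Z\<close> of \<open>B\<close> comes from \<open>A\<close>. Lifting \<open>Y \<rightarrow> Z\<close> itself would require
  splitting off a projective summand, and idempotents need not split in \<open>A\<close>; instead, the
  conflation is exhibited as a pullback of the image of a conflation of \<open>A\<close> with injective middle term.

  Conversely, the exact quasi-inverse of \<open>F'\<close> shows that \<open>F\<close> preserves projectives. A morphism \<open>F f\<close>
  that factors through a projective lifts along \<open>F q\<close> for a deflation \<open>q\<close> from a projective,
  which by fullness makes \<open>f\<close> itself factor through a projective up to a morphism killed by \<open>F\<close>.
\<close>

section \<open>Preadditive categories\<close>

text \<open>Exactness of the comparison functor \<open>F'\<close> comes for free from that of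
  \<open>F\<close>; exactness of its quasi-inverse is not formal, since an equivalence may carry
  conflations into a strictly larger class of conflations. This is why conflations of
  \<open>B\<close> have to be lifted. The projective summand that obstructs the direct approach is
  the one added to \<open>Y\<close> to turn a lift of \<open>Y \<rightarrow> Z\<close> into a
  deflation of \<open>A\<close>: it reappears in the kernel. A conflation with ends
  \<open>F X\<close> and \<open>F Z\<close>, on the other hand, is recovered from a single morphism
  \<open>F Z \<rightarrow> F Q\<close>, its classifying map relative to an inflation of
  \<open>X\<close> into an injective with cokernel \<open>Q\<close>, and single morphisms are what
  fullness lifts. In the converse direction the given removable subcategory may be smaller than the
  essential kernel of \<open>F\<close>; it suffices that it is contained there and that its ideal
  contains every morphism killed by \<open>F\<close>. Hom-sets are disjoint and functors act on
  morphisms without their ends, so existentially bound objects are repeatedly identified by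
  \<open>Hom_disjoint\<close>.\<close>

context preadditive_category
begin

lemma Add_Hom: "f \<in> Hom C X Y \<Longrightarrow> g \<in> Hom C X Y \<Longrightarrow> f \<boxplus> g \<in> Hom C X Y"
  using Hom_Ob[of f X Y] Hom_comm_group[of X Y] monoid.m_closed[of "hom_group C X Y" f g]
  by (simp add: comm_group_def group_def hom_group_def)

lemma Zero_Hom: "X \<in> Ob C \<Longrightarrow> Y \<in> Ob C \<Longrightarrow> Zero C X Y \<in> Hom C X Y"
  using Hom_comm_group[of X Y] monoid.one_closed[of "hom_group C X Y"]
  by (simp add: comm_group_def group_def hom_group_def)

lemma Add_assoc:
  "f \<in> Hom C X Y \<Longrightarrow> g \<in> Hom C X Y \<Longrightarrow> h \<in> Hom C X Y \<Longrightarrow> (f \<boxplus> g) \<boxplus> h = f \<boxplus> (g \<boxplus> h)"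
  using Hom_Ob[of f X Y] Hom_comm_group[of X Y] monoid.m_assoc[of "hom_group C X Y" f g h]
  by (simp add: comm_group_def group_def hom_group_def)

lemma Add_commute: "f \<in> Hom C X Y \<Longrightarrow> g \<in> Hom C X Y \<Longrightarrow> f \<boxplus> g = g \<boxplus> f"
  using Hom_Ob[of f X Y] Hom_comm_group[of X Y] comm_monoid.m_comm[of "hom_group C X Y" f g]
  by (simp add: comm_group_def hom_group_def)

lemma Zero_Add: "f \<in> Hom C X Y \<Longrightarrow> Zero C X Y \<boxplus> f = f"
  using Hom_Ob[of f X Y] Hom_comm_group[of X Y] monoid.l_one[of "hom_group C X Y" f]
  by (simp add: comm_group_def group_def hom_group_def)

lemma Add_Zero: "f \<in> Hom C X Y \<Longrightarrow> f \<boxplus> Zero C X Y = f"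
  using Zero_Add Add_commute Zero_Hom Hom_Ob by metis

lemma ex_negative:
  assumes "f \<in> Hom C X Y" shows "\<exists>g \<in> Hom C X Y. f \<boxplus> g = Zero C X Y"
proof -
  interpret G: comm_group "hom_group C X Y" using assms Hom_Ob Hom_comm_group by blast
  show ?thesis
    using G.inv_closed[of f] G.r_inv[of f] assms by (auto simp: hom_group_def)
qed

lemma Add_left_cancel:
  assumes "f \<in> Hom C X Y" "g \<in> Hom C X Y" "h \<in> Hom C X Y" "f \<boxplus> g = f \<boxplus> h"
  shows "g = h"
proof -
  obtain k where k: "k \<in> Hom C X Y" "f \<boxplus> k = Zero C X Y" using ex_negative assms(1) by blast
  have "k \<boxplus> (f \<boxplus> x) = x" if "x \<in> Hom C X Y" for x
    using Add_assoc[OF k(1) assms(1) that] Add_commute[OF k(1) assms(1)] k(2) Zero_Add[OF that] by simp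
  then show ?thesis using assms by metis
qed

text \<open>The record \<open>cat\<close> has no subtraction, so differences enter later arguments
  as a morphism \<open>d\<close> with \<open>f = g \<boxplus> d\<close>.\<close>

lemma ex_difference:
  assumes "f \<in> Hom C X Y" "g \<in> Hom C X Y"
  obtains d where "d \<in> Hom C X Y" "f = g \<boxplus> d"
proof -
  obtain k where k: "k \<in> Hom C X Y" "g \<boxplus> k = Zero C X Y" using ex_negative assms(2) by blast
  have "f = g \<boxplus> (k \<boxplus> f)"
    using Add_assoc[OF assms(2) k(1) assms(1)] k(2) Zero_Add[OF assms(1)] by simp
  then show ?thesis using that[of "k \<boxplus> f"] Add_Hom[OF k(1) assms(1)] by blast
qed

lemma Comp_Zero:
  assumes "g \<in> Hom C Y Z" "X \<in> Ob C"
  shows "g \<cdot> Zero C X Y = Zero C X Z"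
proof -
  have Y: "Y \<in> Ob C" "Z \<in> Ob C" using assms Hom_Ob by auto
  have z: "Zero C X Y \<in> Hom C X Y" using Zero_Hom assms Y by blast
  then have gz: "g \<cdot> Zero C X Y \<in> Hom C X Z" using Comp_Hom assms by blast
  \<comment> \<open>The locale ties \<open>Zero\<close> to composition only through distributivity:
    the composite equals its own double, and cancellation makes it zero.\<close>
  have "(g \<cdot> Zero C X Y) \<boxplus> (g \<cdot> Zero C X Y) = (g \<cdot> Zero C X Y) \<boxplus> Zero C X Z"
    using Comp_Add[OF z z assms(1)] Zero_Add[OF z] Add_Zero[OF gz] by simp
  then show ?thesis using Add_left_cancel gz Zero_Hom assms Y by blast
qed

lemma Zero_Comp:
  assumes "f \<in> Hom C X Y" "Z \<in> Ob C"
  shows "Zero C Y Z \<cdot> f = Zero C X Z"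
proof -
  have Y: "Y \<in> Ob C" "X \<in> Ob C" using assms Hom_Ob by auto
  have z: "Zero C Y Z \<in> Hom C Y Z" using Zero_Hom assms Y by blast
  then have gz: "Zero C Y Z \<cdot> f \<in> Hom C X Z" using Comp_Hom assms by blast
  have "(Zero C Y Z \<cdot> f) \<boxplus> (Zero C Y Z \<cdot> f) = (Zero C Y Z \<cdot> f) \<boxplus> Zero C X Z"
    using Add_Comp[OF assms(1) z z] Zero_Add[OF z] Add_Zero[OF gz] by simp
  then show ?thesis using Add_left_cancel gz Zero_Hom assms Y by blast
qed

text \<open>Uniqueness of all maps into and out of \<open>Z\<close> becomes one equation between
  endomorphisms, a form that additive functors preserve.\<close>

lemma zero_object_iff: "zero_object C Z \<longleftrightarrow> Z \<in> Ob C \<and> Id C Z = Zero C Z Z"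
proof
  assume "zero_object C Z"
  then show "Z \<in> Ob C \<and> Id C Z = Zero C Z Z"
    unfolding zero_object_def using Id_Hom Zero_Hom by metis
next
  assume Z: "Z \<in> Ob C \<and> Id C Z = Zero C Z Z"
  have "f = Zero C X Z" if "f \<in> Hom C X Z" for f X
    using that Z Id_Comp Zero_Comp by metis
  moreover have "f = Zero C Z X" if "f \<in> Hom C Z X" for f X
    using that Z Comp_Id Comp_Zero by metis
  ultimately show "zero_object C Z"
    unfolding zero_object_def using Z Zero_Hom by blast
qed

section \<open>Isomorphisms and isomorphic pairs\<close>

lemma is_iso_inverse:
  assumes "is_iso C X Y f"
  obtains g where "is_iso C Y X g" "g \<in> Hom C Y X" "g \<cdot> f = Id C X" "f \<cdot> g = Id C Y"
  using assms unfolding is_iso_def by blast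

lemma is_iso_Id: "X \<in> Ob C \<Longrightarrow> is_iso C X X (Id C X)"
  unfolding is_iso_def using Id_Hom Comp_Id by blast

lemma is_iso_Comp:
  assumes "is_iso C X Y f" "is_iso C Y Z g"
  shows "is_iso C X Z (g \<cdot> f)"
proof -
  obtain f' where f: "f \<in> Hom C X Y" "f' \<in> Hom C Y X" "f' \<cdot> f = Id C X" "f \<cdot> f' = Id C Y"
    using assms(1) unfolding is_iso_def by blast
  obtain g' where g: "g \<in> Hom C Y Z" "g' \<in> Hom C Z Y" "g' \<cdot> g = Id C Y" "g \<cdot> g' = Id C Z"
    using assms(2) unfolding is_iso_def by blast
  note gf = Comp_Hom[OF f(1) g(1)] and fg = Comp_Hom[OF g(2) f(2)]
  have "(f' \<cdot> g') \<cdot> (g \<cdot> f) = Id C X"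
    using Comp_assoc[OF f(1) g(1) fg] Comp_assoc[OF g(1,2) f(2)] g(3) Comp_Id[OF f(2)] f(3) by simp
  moreover have "(g \<cdot> f) \<cdot> (f' \<cdot> g') = Id C Z"
    using Comp_assoc[OF g(2) f(2) gf] Comp_assoc[OF f(2,1) g(1)] f(4) Comp_Id[OF g(1)] g(4) by simp
  ultimately show ?thesis unfolding is_iso_def using gf fg by blast
qed

lemma iso_left_cancel:
  assumes "is_iso C Y Z u" "f \<in> Hom C X Y" "g \<in> Hom C X Y" "u \<cdot> f = u \<cdot> g"
  shows "f = g"
proof -
  obtain v where u: "u \<in> Hom C Y Z" "v \<in> Hom C Z Y" "v \<cdot> u = Id C Y"
    using assms(1) unfolding is_iso_def by blast
  show ?thesis
    using Comp_assoc[OF assms(2) u(1,2)] Comp_assoc[OF assms(3) u(1,2)] assms(4) u(3)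
      Id_Comp[OF assms(2)] Id_Comp[OF assms(3)] by metis
qed

lemma iso_right_cancel:
  assumes "is_iso C X Y u" "f \<in> Hom C Y Z" "g \<in> Hom C Y Z" "f \<cdot> u = g \<cdot> u"
  shows "f = g"
proof -
  obtain v where u: "u \<in> Hom C X Y" "v \<in> Hom C Y X" "u \<cdot> v = Id C Y"
    using assms(1) unfolding is_iso_def by blast
  show ?thesis
    using Comp_assoc[OF u(2,1) assms(2)] Comp_assoc[OF u(2,1) assms(3)] assms(4) u(3)
      Comp_Id[OF assms(2)] Comp_Id[OF assms(3)] by metis
qed

lemma iso_pairs_refl:
  assumes "i \<in> Hom C X Y" "p \<in> Hom C Y Z"
  shows "iso_pairs C (i, p) (i, p)"
proof -
  have "Id C Y \<cdot> i = i \<cdot> Id C X" "Id C Z \<cdot> p = p \<cdot> Id C Y"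
    using assms Comp_Id Id_Comp by auto
  then show ?thesis
    unfolding iso_pairs_def using assms is_iso_Id Hom_Ob by blast
qed

lemma iso_pairs_trans:
  assumes "iso_pairs C (i, p) (i', p')" "iso_pairs C (i', p') (i'', p'')"
  shows "iso_pairs C (i, p) (i'', p'')"
proof -
  obtain X Y Z X' Y' Z' a b c where 1:
    "i \<in> Hom C X Y" "p \<in> Hom C Y Z" "i' \<in> Hom C X' Y'" "p' \<in> Hom C Y' Z'"
    "is_iso C X X' a" "is_iso C Y Y' b" "is_iso C Z Z' c" "b \<cdot> i = i' \<cdot> a" "c \<cdot> p = p' \<cdot> b"
    using assms(1) unfolding iso_pairs_def by blast
  obtain X1 Y1 Z1 X'' Y'' Z'' a' b' c' where "i' \<in> Hom C X1 Y1" "p' \<in> Hom C Y1 Z1" and 2: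
    "i'' \<in> Hom C X'' Y''" "p'' \<in> Hom C Y'' Z''" and 3:
    "is_iso C X1 X'' a'" "is_iso C Y1 Y'' b'" "is_iso C Z1 Z'' c'"
    and 4: "b' \<cdot> i' = i'' \<cdot> a'" "c' \<cdot> p' = p'' \<cdot> b'"
    using assms(2) unfolding iso_pairs_def by blast
  \<comment> \<open>\<open>iso_pairs\<close> hides its objects, so the two hypotheses share only the
    morphisms \<open>i'\<close> and \<open>p'\<close>; disjointness of hom-sets identifies the
    middle objects.\<close>
  then have eq: "X1 = X'" "Y1 = Y'" "Z1 = Z'" using 1 Hom_disjoint by blast+
  note 3 = 3[unfolded eq]
  note H = 1(5-7)[unfolded is_iso_def, THEN conjunct1] 3[unfolded is_iso_def, THEN conjunct1]
  have "(b' \<cdot> b) \<cdot> i = i'' \<cdot> (a' \<cdot> a)"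
    using Comp_assoc[OF 1(1) H(2) H(5)] Comp_assoc[OF H(1) 1(3) H(5)]
      Comp_assoc[OF H(1) H(4) 2(1)] 1 4 by simp
  moreover have "(c' \<cdot> c) \<cdot> p = p'' \<cdot> (b' \<cdot> b)"
    using Comp_assoc[OF 1(2) H(3) H(6)] Comp_assoc[OF H(2) 1(4) H(6)]
      Comp_assoc[OF H(2) H(5) 2(2)] 1 4 by simp
  moreover have "is_iso C X X'' (a' \<cdot> a)" "is_iso C Y Y'' (b' \<cdot> b)" "is_iso C Z Z'' (c' \<cdot> c)"
    using 1 3 is_iso_Comp by blast+
  ultimately show ?thesis
    unfolding iso_pairs_def using 1(1,2) 2 by blast
qed

lemma iso_pairs_sym:
  assumes "iso_pairs C (i, p) (i', p')"
  shows "iso_pairs C (i', p') (i, p)"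
proof -
  obtain X Y Z X' Y' Z' a b c where 1:
    "i \<in> Hom C X Y" "p \<in> Hom C Y Z" "i' \<in> Hom C X' Y'" "p' \<in> Hom C Y' Z'"
    "is_iso C X X' a" "is_iso C Y Y' b" "is_iso C Z Z' c" "b \<cdot> i = i' \<cdot> a" "c \<cdot> p = p' \<cdot> b"
    using assms(1) unfolding iso_pairs_def by blast
  \<comment> \<open>Reverses one commuting square with invertible verticals: \<open>g\<close> is
    rewritten as \<open>g \<cdot> u \<cdot> u'\<close>, and \<open>v'\<close> then cancels
    \<open>v\<close>. It is applied to the left and to the right square.\<close>
  have inv: "v' \<cdot> g = f \<cdot> u'"
    if "is_iso C U U' u" "v \<in> Hom C V V'" "u' \<in> Hom C U' U" "u \<cdot> u' = Id C U'"
      "v' \<in> Hom C V' V" "v' \<cdot> v = Id C V" "f \<in> Hom C U V" "g \<in> Hom C U' V'" "v \<cdot> f = g \<cdot> u"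
    for U U' V V' u v u' v' f g
  proof -
    have u: "u \<in> Hom C U U'" using that(1) is_iso_def by metis
    have vg: "v' \<cdot> g \<in> Hom C U' V" using that Comp_Hom by blast
    have "v' \<cdot> g = ((v' \<cdot> g) \<cdot> u) \<cdot> u'"
      using Comp_assoc[OF that(3) u vg] that(4) Comp_Id[OF vg] by simp
    also have "(v' \<cdot> g) \<cdot> u = v' \<cdot> (v \<cdot> f)"
      using Comp_assoc[OF u that(8,5)] that(9) by simp
    also have "\<dots> = f" using Comp_assoc[OF that(7,2,5)] that(6) Id_Comp[OF that(7)] by simp
    finally show ?thesis .
  qed
  obtain a' where a: "is_iso C X' X a'" "a' \<in> Hom C X' X" "a' \<cdot> a = Id C X" "a \<cdot> a' = Id C X'"
    using is_iso_inverse 1 by blast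
  obtain b' where b: "is_iso C Y' Y b'" "b' \<in> Hom C Y' Y" "b' \<cdot> b = Id C Y" "b \<cdot> b' = Id C Y'"
    using is_iso_inverse 1 by blast
  obtain c' where c: "is_iso C Z' Z c'" "c' \<in> Hom C Z' Z" "c' \<cdot> c = Id C Z" "c \<cdot> c' = Id C Z'"
    using is_iso_inverse 1 by blast
  have "b \<in> Hom C Y Y'" "c \<in> Hom C Z Z'" using 1 is_iso_def by metis+
  then have "b' \<cdot> i' = i \<cdot> a'" "c' \<cdot> p' = p \<cdot> b'"
    using inv[OF 1(5) _ a(2) a(4) b(2,3) 1(1,3,8)] inv[OF 1(6) _ b(2) b(4) c(2,3) 1(2,4,9)] by blast+
  then show ?thesis unfolding iso_pairs_def using 1 a b c by blast
qed

end

section \<open>Functors\<close>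

definition faithful_functor ::
  "('o1, 'm1) cat \<Rightarrow> ('o2, 'm2) cat \<Rightarrow> ('o1, 'm1, 'o2, 'm2) func \<Rightarrow> bool" where
  "faithful_functor A B F \<longleftrightarrow>
     (\<forall>X Y. \<forall>f \<in> Hom A X Y. \<forall>g \<in> Hom A X Y. fhom F f = fhom F g \<longrightarrow> f = g)"

lemma functor_Ob: "is_functor A B F \<Longrightarrow> X \<in> Ob A \<Longrightarrow> fob F X \<in> Ob B"
  and functor_Hom: "is_functor A B F \<Longrightarrow> f \<in> Hom A X Y \<Longrightarrow> fhom F f \<in> Hom B (fob F X) (fob F Y)"
  and functor_Id: "is_functor A B F \<Longrightarrow> X \<in> Ob A \<Longrightarrow> fhom F (Id A X) = Id B (fob F X)"
  and functor_Comp: "is_functor A B F \<Longrightarrow> f \<in> Hom A X Y \<Longrightarrow> g \<in> Hom A Y Z \<Longrightarrow>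
    fhom F (g \<cdot>\<^bsub>A\<^esub> f) = fhom F g \<cdot>\<^bsub>B\<^esub> fhom F f"
  unfolding is_functor_def by blast+

lemma faithfulD:
  "faithful_functor A B F \<Longrightarrow> f \<in> Hom A X Y \<Longrightarrow> g \<in> Hom A X Y \<Longrightarrow> fhom F f = fhom F g \<Longrightarrow> f = g"
  unfolding faithful_functor_def by blast

lemma additive_functor_Add:
  "additive_functor A B F \<Longrightarrow> f \<in> Hom A X Y \<Longrightarrow> g \<in> Hom A X Y \<Longrightarrow>
    fhom F (f \<boxplus>\<^bsub>A\<^esub> g) = fhom F f \<boxplus>\<^bsub>B\<^esub> fhom F g"
  unfolding additive_functor_def by blast

text \<open>\<open>additive_functor\<close> speaks of sums only; the image of zero equals its own
  double and is therefore zero.\<close>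

lemma additive_functor_Zero:
  assumes "preadditive_category A" "preadditive_category B" "additive_functor A B F"
    and "X \<in> Ob A" "Y \<in> Ob A"
  shows "fhom F (Zero A X Y) = Zero B (fob F X) (fob F Y)"
proof -
  interpret A: preadditive_category A by fact
  interpret B: preadditive_category B by fact
  have F: "is_functor A B F" using assms additive_functor_def by blast
  note z = A.Zero_Hom[OF assms(4,5)]
  note Fz = functor_Hom[OF F z]
  have "fhom F (Zero A X Y) \<boxplus>\<^bsub>B\<^esub> fhom F (Zero A X Y) = fhom F (Zero A X Y) \<boxplus>\<^bsub>B\<^esub> Zero B (fob F X) (fob F Y)"
    using additive_functor_Add[OF assms(3) z z] A.Add_Zero[OF z] B.Add_Zero[OF Fz] by simp
  then show ?thesis using B.Add_left_cancel Fz B.Zero_Hom B.Hom_Ob by metis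
qed

lemma functor_is_iso:
  assumes F: "is_functor A B F" and "preadditive_category A" "is_iso A X Y f"
  shows "is_iso B (fob F X) (fob F Y) (fhom F f)"
proof -
  obtain g where f: "f \<in> Hom A X Y" "g \<in> Hom A Y X" "g \<cdot>\<^bsub>A\<^esub> f = Id A X" "f \<cdot>\<^bsub>A\<^esub> g = Id A Y"
    using assms(3) unfolding is_iso_def by blast
  have "X \<in> Ob A" "Y \<in> Ob A" using preadditive_category.Hom_Ob[OF assms(2) f(1)] by auto
  then have "fhom F g \<cdot>\<^bsub>B\<^esub> fhom F f = Id B (fob F X)" "fhom F f \<cdot>\<^bsub>B\<^esub> fhom F g = Id B (fob F Y)"
    using functor_Comp[OF F f(1,2)] functor_Comp[OF F f(2,1)] functor_Id[OF F] f(3,4) by metis+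
  then show ?thesis unfolding is_iso_def using functor_Hom[OF F] f by blast
qed

lemma functor_iso_pairs:
  assumes "is_functor A B F" "preadditive_category A" "iso_pairs A (i, p) (i', p')"
  shows "iso_pairs B (fhom F i, fhom F p) (fhom F i', fhom F p')"
proof -
  obtain X Y Z X' Y' Z' a b c where 1:
    "i \<in> Hom A X Y" "p \<in> Hom A Y Z" "i' \<in> Hom A X' Y'" "p' \<in> Hom A Y' Z'"
    "is_iso A X X' a" "is_iso A Y Y' b" "is_iso A Z Z' c"
    "b \<cdot>\<^bsub>A\<^esub> i = i' \<cdot>\<^bsub>A\<^esub> a" "c \<cdot>\<^bsub>A\<^esub> p = p' \<cdot>\<^bsub>A\<^esub> b"
    using assms(3) unfolding iso_pairs_def by blast
  note H = 1(5-7)[unfolded is_iso_def, THEN conjunct1]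
  have "fhom F b \<cdot>\<^bsub>B\<^esub> fhom F i = fhom F i' \<cdot>\<^bsub>B\<^esub> fhom F a"
    "fhom F c \<cdot>\<^bsub>B\<^esub> fhom F p = fhom F p' \<cdot>\<^bsub>B\<^esub> fhom F b"
    using 1 H functor_Comp[OF assms(1)] by metis+
  then show ?thesis
    unfolding iso_pairs_def
    using functor_Hom[OF assms(1)] functor_is_iso[OF assms(1,2)] 1 by blast
qed

section \<open>Equivalences of preadditive categories\<close>

lemma quasi_inverse_sym: "quasi_inverse A B F G \<Longrightarrow> quasi_inverse B A G F"
  unfolding quasi_inverse_def by blast

lemma naturally_isomorphic_comp_id:
  assumes "naturally_isomorphic A A (comp_functor G F) id_functor"
  obtains e where "\<And>X. X \<in> Ob A \<Longrightarrow> is_iso A (fob G (fob F X)) X (e X)"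
    "\<And>f X Y. f \<in> Hom A X Y \<Longrightarrow> e Y \<cdot>\<^bsub>A\<^esub> fhom G (fhom F f) = f \<cdot>\<^bsub>A\<^esub> e X"
proof -
  obtain e where e: "\<forall>X \<in> Ob A. is_iso A (fob G (fob F X)) X (e X)"
    "\<forall>X Y. \<forall>f \<in> Hom A X Y. e Y \<cdot>\<^bsub>A\<^esub> fhom G (fhom F f) = f \<cdot>\<^bsub>A\<^esub> e X"
    using assms unfolding naturally_isomorphic_def comp_functor_def id_functor_def by auto
  show ?thesis by (rule that[of e]) (use e in blast)+
qed

lemma naturally_isomorphic_comp_idI:
  assumes "\<And>X. X \<in> Ob A \<Longrightarrow> is_iso A (fob G (fob F X)) X (e X)"
    "\<And>f X Y. f \<in> Hom A X Y \<Longrightarrow> e Y \<cdot>\<^bsub>A\<^esub> fhom G (fhom F f) = f \<cdot>\<^bsub>A\<^esub> e X"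
  shows "naturally_isomorphic A A (comp_functor G F) id_functor"
  unfolding naturally_isomorphic_def comp_functor_def id_functor_def
  by (rule exI[of _ e]) (use assms in simp)

text \<open>Naturality conjugates \<open>f\<close> into \<open>G (F f)\<close> by isomorphisms that
  depend only on \<open>X\<close> and \<open>Y\<close>, so \<open>F f\<close> determines
  \<open>f\<close>.\<close>

lemma quasi_inverse_faithful:
  assumes "preadditive_category A" "quasi_inverse A B F G"
  shows "faithful_functor A B F"
  unfolding faithful_functor_def
proof (intro allI ballI impI)
  fix X Y f g assume f: "f \<in> Hom A X Y" "g \<in> Hom A X Y" "fhom F f = fhom F g"
  interpret A: preadditive_category A by fact
  obtain e where e: "\<And>X. X \<in> Ob A \<Longrightarrow> is_iso A (fob G (fob F X)) X (e X)"
    "\<And>f X Y. f \<in> Hom A X Y \<Longrightarrow> e Y \<cdot>\<^bsub>A\<^esub> fhom G (fhom F f) = f \<cdot>\<^bsub>A\<^esub> e X"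
    using assms naturally_isomorphic_comp_id unfolding quasi_inverse_def by blast
  have "f \<cdot>\<^bsub>A\<^esub> e X = g \<cdot>\<^bsub>A\<^esub> e X" using e(2) f by metis
  then show "f = g" using A.iso_right_cancel e(1) A.Hom_Ob f by metis
qed

text \<open>The preimage of \<open>g\<close> is \<open>G g\<close> conjugated by the natural
  isomorphism \<open>e\<close>. Its image agrees with \<open>g\<close> after applying
  \<open>G\<close>, which is faithful by symmetry.\<close>

lemma quasi_inverse_full:
  assumes "preadditive_category A" "preadditive_category B" "quasi_inverse A B F G"
  shows "full_functor A B F"
  unfolding full_functor_def
proof (intro ballI)
  fix X Y g assume X: "X \<in> Ob A" "Y \<in> Ob A" and g: "g \<in> Hom B (fob F X) (fob F Y)"
  interpret A: preadditive_category A by fact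
  interpret B: preadditive_category B by fact
  obtain e where e: "\<And>X. X \<in> Ob A \<Longrightarrow> is_iso A (fob G (fob F X)) X (e X)"
    "\<And>f X Y. f \<in> Hom A X Y \<Longrightarrow> e Y \<cdot>\<^bsub>A\<^esub> fhom G (fhom F f) = f \<cdot>\<^bsub>A\<^esub> e X"
    using assms naturally_isomorphic_comp_id unfolding quasi_inverse_def by blast
  have F: "is_functor A B F" "is_functor B A G" using assms unfolding quasi_inverse_def by auto
  obtain d where d: "d \<in> Hom A X (fob G (fob F X))" "d \<cdot>\<^bsub>A\<^esub> e X = Id A (fob G (fob F X))"
    using A.is_iso_inverse[OF e(1)[OF X(1)]] by blast
  have eH: "e X \<in> Hom A (fob G (fob F X)) X" "e Y \<in> Hom A (fob G (fob F Y)) Y"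
    using e(1) X is_iso_def by metis+
  note Gg = functor_Hom[OF F(2) g]
  define f where "f = (e Y \<cdot>\<^bsub>A\<^esub> fhom G g) \<cdot>\<^bsub>A\<^esub> d"
  have eg: "e Y \<cdot>\<^bsub>A\<^esub> fhom G g \<in> Hom A (fob G (fob F X)) Y" using A.Comp_Hom Gg eH by blast
  have f: "f \<in> Hom A X Y" unfolding f_def using A.Comp_Hom eg d by blast
  have "f \<cdot>\<^bsub>A\<^esub> e X = e Y \<cdot>\<^bsub>A\<^esub> fhom G g"
    unfolding f_def using A.Comp_assoc[OF eH(1) d(1) eg] d(2) A.Comp_Id[OF eg] by simp
  then have "fhom G (fhom F f) = fhom G g"
    using A.iso_left_cancel[OF e(1)[OF X(2)] _ Gg] functor_Hom[OF F(2)] functor_Hom[OF F(1) f] e(2)[OF f]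
    by metis
  then have "fhom F f = g"
    using faithfulD[OF quasi_inverse_faithful[OF assms(2) quasi_inverse_sym[OF assms(3)]]]
      functor_Hom[OF F(1) f] g by metis
  then show "\<exists>f\<in>Hom A X Y. fhom F f = g" using f by blast
qed

lemma quasi_inverse_dense:
  assumes "quasi_inverse A B F G"
  shows "dense_functor A B F"
  using assms naturally_isomorphic_comp_id[of B F G] functor_Ob[of B A G]
  unfolding quasi_inverse_def dense_functor_def isomorphic_def by metis

text \<open>Since \<open>F\<close> is additive and faithful, the two morphisms can be compared after
  \<open>F\<close>; composed with the natural isomorphism from \<open>F G\<close> to the identity,
  both become \<open>(f \<boxplus> g) \<cdot> e X\<close>.\<close>

lemma quasi_inverse_additive:
  assumes "preadditive_category A" "preadditive_category B" "quasi_inverse A B F G"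
    and "additive_functor A B F"
  shows "additive_functor B A G"
  unfolding additive_functor_def
proof (intro conjI allI ballI)
  interpret A: preadditive_category A by fact
  interpret B: preadditive_category B by fact
  show G: "is_functor B A G" using assms unfolding quasi_inverse_def by blast
  have F: "is_functor A B F" using assms unfolding quasi_inverse_def by blast
  obtain e where e: "\<And>X. X \<in> Ob B \<Longrightarrow> is_iso B (fob F (fob G X)) X (e X)"
    "\<And>f X Y. f \<in> Hom B X Y \<Longrightarrow> e Y \<cdot>\<^bsub>B\<^esub> fhom F (fhom G f) = f \<cdot>\<^bsub>B\<^esub> e X"
    using assms naturally_isomorphic_comp_id unfolding quasi_inverse_def by blast
  fix X Y f g assume f: "f \<in> Hom B X Y" and g: "g \<in> Hom B X Y"
  have eH: "e X \<in> Hom B (fob F (fob G X)) X" "e Y \<in> Hom B (fob F (fob G Y)) Y"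
    using e(1) B.Hom_Ob f is_iso_def by metis+
  note FG = functor_Hom[OF F functor_Hom[OF G]]
  note fg = B.Add_Hom[OF f g]
  have "e Y \<cdot>\<^bsub>B\<^esub> fhom F (fhom G (f \<boxplus>\<^bsub>B\<^esub> g)) = (f \<cdot>\<^bsub>B\<^esub> e X) \<boxplus>\<^bsub>B\<^esub> (g \<cdot>\<^bsub>B\<^esub> e X)"
    using e(2)[OF fg] B.Add_Comp[OF eH(1) f g] by simp
  also have "\<dots> = e Y \<cdot>\<^bsub>B\<^esub> fhom F (fhom G f \<boxplus>\<^bsub>A\<^esub> fhom G g)"
    using e(2) f g B.Comp_Add[OF FG[OF f] FG[OF g] eH(2)]
      additive_functor_Add[OF assms(4) functor_Hom[OF G f] functor_Hom[OF G g]] by simp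
  finally have "fhom F (fhom G (f \<boxplus>\<^bsub>B\<^esub> g)) = fhom F (fhom G f \<boxplus>\<^bsub>A\<^esub> fhom G g)"
    using B.iso_left_cancel[OF e(1)[of Y] FG[OF fg] functor_Hom[OF F A.Add_Hom]]
      functor_Hom[OF G f] functor_Hom[OF G g] B.Hom_Ob f by blast
  then show "fhom G (f \<boxplus>\<^bsub>B\<^esub> g) = fhom G f \<boxplus>\<^bsub>A\<^esub> fhom G g"
    using faithfulD[OF quasi_inverse_faithful[OF assms(1,3)]] functor_Hom[OF G] A.Add_Hom f g fg by metis
qed

lemma fully_faithful_dense_quasi_inverse:
  assumes "preadditive_category A" "preadditive_category B" "is_functor A B F"
    and "full_functor A B F" "faithful_functor A B F" "dense_functor A B F"
  obtains G where "quasi_inverse A B F G"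
proof -
  interpret A: preadditive_category A by fact
  interpret B: preadditive_category B by fact
  note F = assms(3)
  have "\<forall>Y. Y \<in> Ob B \<longrightarrow> (\<exists>X u u'. X \<in> Ob A \<and> is_iso B (fob F X) Y u \<and> u \<in> Hom B (fob F X) Y \<and>
      u' \<in> Hom B Y (fob F X) \<and> u' \<cdot>\<^bsub>B\<^esub> u = Id B (fob F X) \<and> u \<cdot>\<^bsub>B\<^esub> u' = Id B Y)"
    using assms(6) unfolding dense_functor_def isomorphic_def is_iso_def by blast
  then obtain g e e' where ge: "\<And>Y. Y \<in> Ob B \<Longrightarrow> g Y \<in> Ob A \<and> is_iso B (fob F (g Y)) Y (e Y) \<and>
      e Y \<in> Hom B (fob F (g Y)) Y \<and> e' Y \<in> Hom B Y (fob F (g Y)) \<and>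
      e' Y \<cdot>\<^bsub>B\<^esub> e Y = Id B (fob F (g Y)) \<and> e Y \<cdot>\<^bsub>B\<^esub> e' Y = Id B Y"
    by metis
  have g: "\<And>Y. Y \<in> Ob B \<Longrightarrow> g Y \<in> Ob A"
    and e_iso: "\<And>Y. Y \<in> Ob B \<Longrightarrow> is_iso B (fob F (g Y)) Y (e Y)"
    and e: "\<And>Y. Y \<in> Ob B \<Longrightarrow> e Y \<in> Hom B (fob F (g Y)) Y"
    and e': "\<And>Y. Y \<in> Ob B \<Longrightarrow> e' Y \<in> Hom B Y (fob F (g Y))"
    and e'e: "\<And>Y. Y \<in> Ob B \<Longrightarrow> e' Y \<cdot>\<^bsub>B\<^esub> e Y = Id B (fob F (g Y))"
    and ee': "\<And>Y. Y \<in> Ob B \<Longrightarrow> e Y \<cdot>\<^bsub>B\<^esub> e' Y = Id B Y"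
    using ge by blast+
  have full: "\<exists>f \<in> Hom A X Y. fhom F f = h" if "X \<in> Ob A" "Y \<in> Ob A" "h \<in> Hom B (fob F X) (fob F Y)" for X Y h
    using assms(4) that unfolding full_functor_def by blast
  \<comment> \<open>\<open>fhom\<close> sees only the morphism, so its ends are quantified inside
    the choice and recovered by disjointness. By \<open>uniq\<close> the chosen lift is the only one
    compatible with \<open>e\<close>, and the functor laws follow from that.\<close>
  define m where "m f = (SOME h. \<exists>Y Z. f \<in> Hom B Y Z \<and> h \<in> Hom A (g Y) (g Z) \<and>
      e Z \<cdot>\<^bsub>B\<^esub> fhom F h = f \<cdot>\<^bsub>B\<^esub> e Y)" for f
  have m: "m f \<in> Hom A (g Y) (g Z) \<and> e Z \<cdot>\<^bsub>B\<^esub> fhom F (m f) = f \<cdot>\<^bsub>B\<^esub> e Y" if f: "f \<in> Hom B Y Z" for f Y Z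
  proof -
    have Y: "Y \<in> Ob B" "Z \<in> Ob B" using f B.Hom_Ob by auto
    note fe = B.Comp_Hom[OF e[OF Y(1)] f]
    obtain h where h: "h \<in> Hom A (g Y) (g Z)" "fhom F h = e' Z \<cdot>\<^bsub>B\<^esub> (f \<cdot>\<^bsub>B\<^esub> e Y)"
      using full g Y B.Comp_Hom[OF fe e'[OF Y(2)]] by blast
    have "e Z \<cdot>\<^bsub>B\<^esub> fhom F h = f \<cdot>\<^bsub>B\<^esub> e Y"
      using h(2) B.Comp_assoc[OF fe e'[OF Y(2)] e[OF Y(2)]] ee'[OF Y(2)] B.Id_Comp[OF fe] by simp
    then have "\<exists>h. \<exists>Y Z. f \<in> Hom B Y Z \<and> h \<in> Hom A (g Y) (g Z) \<and> e Z \<cdot>\<^bsub>B\<^esub> fhom F h = f \<cdot>\<^bsub>B\<^esub> e Y"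
      using h f by blast
    then have "\<exists>Y Z. f \<in> Hom B Y Z \<and> m f \<in> Hom A (g Y) (g Z) \<and> e Z \<cdot>\<^bsub>B\<^esub> fhom F (m f) = f \<cdot>\<^bsub>B\<^esub> e Y"
      unfolding m_def by (rule someI_ex)
    then show ?thesis using B.Hom_disjoint f by metis
  qed
  have uniq: "h = m f" if f: "f \<in> Hom B Y Z" and h: "h \<in> Hom A (g Y) (g Z)"
      "e Z \<cdot>\<^bsub>B\<^esub> fhom F h = f \<cdot>\<^bsub>B\<^esub> e Y" for f h Y Z
  proof -
    have "fhom F h = fhom F (m f)"
      using B.iso_left_cancel[OF e_iso functor_Hom[OF F h(1)] functor_Hom[OF F conjunct1[OF m[OF f]]]]
        h m[OF f] f B.Hom_Ob by metis
    then show ?thesis using faithfulD[OF assms(5) h(1)] m[OF f] by blast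
  qed
  define G where "G = \<lparr>fob = g, fhom = m\<rparr>"
  have Gs: "fob G = g" "fhom G = m" unfolding G_def by simp_all
  have G: "is_functor B A G"
    unfolding is_functor_def Gs
  proof (intro conjI ballI allI)
    fix X assume X: "X \<in> Ob B"
    show "g X \<in> Ob A" using X g by blast
    have "e X \<cdot>\<^bsub>B\<^esub> fhom F (Id A (g X)) = Id B X \<cdot>\<^bsub>B\<^esub> e X"
      using functor_Id[OF F] g e X B.Id_Comp B.Comp_Id by metis
    then show "m (Id B X) = Id A (g X)"
      using uniq[OF B.Id_Hom[OF X] A.Id_Hom[OF g[OF X]]] by simp
  next
    fix X Y f assume "f \<in> Hom B X Y"
    then show "m f \<in> Hom A (g X) (g Y)" using m by blast
  next
    fix X Y Z f k assume f: "f \<in> Hom B X Y" and k: "k \<in> Hom B Y Z"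
    have O: "X \<in> Ob B" "Y \<in> Ob B" "Z \<in> Ob B" using f k B.Hom_Ob by auto
    note mf = m[OF f, THEN conjunct1] and mk = m[OF k, THEN conjunct1]
    note Ff = functor_Hom[OF F mf] and Fk = functor_Hom[OF F mk]
    have "e Z \<cdot>\<^bsub>B\<^esub> fhom F (m k \<cdot>\<^bsub>A\<^esub> m f) = (e Z \<cdot>\<^bsub>B\<^esub> fhom F (m k)) \<cdot>\<^bsub>B\<^esub> fhom F (m f)"
      using functor_Comp[OF F mf mk] B.Comp_assoc[OF Ff Fk e[OF O(3)]] by simp
    also have "\<dots> = k \<cdot>\<^bsub>B\<^esub> (f \<cdot>\<^bsub>B\<^esub> e X)"
      using m[OF k] m[OF f] B.Comp_assoc[OF Ff e[OF O(2)] k] by simp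
    also have "\<dots> = (k \<cdot>\<^bsub>B\<^esub> f) \<cdot>\<^bsub>B\<^esub> e X" using B.Comp_assoc[OF e[OF O(1)] f k] by simp
    finally show "m (k \<cdot>\<^bsub>B\<^esub> f) = m k \<cdot>\<^bsub>A\<^esub> m f"
      using uniq[OF B.Comp_Hom[OF f k] A.Comp_Hom[OF mf mk]] by simp
  qed
  have "naturally_isomorphic B B (comp_functor F G) id_functor"
    by (rule naturally_isomorphic_comp_idI[where e = e]) (use e_iso m in \<open>auto simp: Gs\<close>)
  moreover have "naturally_isomorphic A A (comp_functor G F) id_functor"
  proof -
    \<comment> \<open>The other natural isomorphism is a lift of \<open>e\<close> at the objects
      \<open>F X\<close>; it is invertible because \<open>e'\<close> lifts as well and
      \<open>F\<close> is faithful.\<close>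
    have "\<forall>X. X \<in> Ob A \<longrightarrow> (\<exists>t. is_iso A (g (fob F X)) X t \<and> fhom F t = e (fob F X))"
    proof (intro allI impI)
      fix X assume X: "X \<in> Ob A"
      note FX = functor_Ob[OF F X]
      obtain t where t: "t \<in> Hom A (g (fob F X)) X" "fhom F t = e (fob F X)"
        using full[OF g[OF FX] X e[OF FX]] by blast
      obtain t' where t': "t' \<in> Hom A X (g (fob F X))" "fhom F t' = e' (fob F X)"
        using full[OF X g[OF FX] e'[OF FX]] by blast
      have "t' \<cdot>\<^bsub>A\<^esub> t = Id A (g (fob F X))"
        using faithfulD[OF assms(5) A.Comp_Hom[OF t(1) t'(1)] A.Id_Hom[OF g[OF FX]]]
          functor_Comp[OF F t(1) t'(1)] functor_Id[OF F g[OF FX]] t t' e'e[OF FX] by simp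
      moreover have "t \<cdot>\<^bsub>A\<^esub> t' = Id A X"
        using faithfulD[OF assms(5) A.Comp_Hom[OF t'(1) t(1)] A.Id_Hom[OF X]]
          functor_Comp[OF F t'(1) t(1)] functor_Id[OF F X] t t' ee'[OF FX] by simp
      ultimately show "\<exists>t. is_iso A (g (fob F X)) X t \<and> fhom F t = e (fob F X)"
        unfolding is_iso_def using t t' by blast
    qed
    then obtain t where t: "\<And>X. X \<in> Ob A \<Longrightarrow> is_iso A (g (fob F X)) X (t X)"
      "\<And>X. X \<in> Ob A \<Longrightarrow> fhom F (t X) = e (fob F X)" by metis
    have "t Y \<cdot>\<^bsub>A\<^esub> m (fhom F f) = f \<cdot>\<^bsub>A\<^esub> t X" if f: "f \<in> Hom A X Y" for f X Y
    proof -
      have O: "X \<in> Ob A" "Y \<in> Ob A" using A.Hom_Ob f by auto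
      note tH = t(1)[OF O(1), unfolded is_iso_def, THEN conjunct1]
        t(1)[OF O(2), unfolded is_iso_def, THEN conjunct1]
      note mF = m[OF functor_Hom[OF F f]]
      show ?thesis
        using faithfulD[OF assms(5) A.Comp_Hom[OF conjunct1[OF mF] tH(2)] A.Comp_Hom[OF tH(1) f]]
          functor_Comp[OF F conjunct1[OF mF] tH(2)] functor_Comp[OF F tH(1) f] t(2) O mF by simp
    qed
    then show ?thesis
      by (intro naturally_isomorphic_comp_idI[where e = t]) (use t(1) in \<open>auto simp: Gs\<close>)
  qed
  ultimately have "quasi_inverse A B F G" unfolding quasi_inverse_def using F G by blast
  then show ?thesis by (rule that)
qed


text \<open>Reduces injectivity to a trivial kernel, the form in which ideals of morphisms can be
  used.\<close>

lemma additive_faithfulI: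
  assumes "preadditive_category A" "preadditive_category B" "additive_functor A B F"
    and "\<And>X Y f. f \<in> Hom A X Y \<Longrightarrow> fhom F f = Zero B (fob F X) (fob F Y) \<Longrightarrow> f = Zero A X Y"
  shows "faithful_functor A B F"
  unfolding faithful_functor_def
proof (intro allI ballI impI)
  fix X Y f g assume f: "f \<in> Hom A X Y" "g \<in> Hom A X Y" "fhom F f = fhom F g"
  interpret A: preadditive_category A by fact
  interpret B: preadditive_category B by fact
  have F: "is_functor A B F" using assms additive_functor_def by blast
  obtain d where d: "d \<in> Hom A X Y" "f = g \<boxplus>\<^bsub>A\<^esub> d" using A.ex_difference[OF f(1,2)] by blast
  note Fg = functor_Hom[OF F f(2)] and Fd = functor_Hom[OF F d(1)]
  have "fhom F g \<boxplus>\<^bsub>B\<^esub> fhom F d = fhom F g \<boxplus>\<^bsub>B\<^esub> Zero B (fob F X) (fob F Y)"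
    using additive_functor_Add[OF assms(3) f(2) d(1)] d(2) f(3) B.Add_Zero[OF Fg] by simp
  then have "fhom F d = Zero B (fob F X) (fob F Y)"
    using B.Add_left_cancel[OF Fg Fd] B.Zero_Hom B.Hom_Ob Fg by blast
  then have "d = Zero A X Y" by (rule assms(4)[OF d(1)])
  then show "f = g" using d(2) A.Add_Zero[OF f(2)] by simp
qed

lemma comp_functor_simps [simp]:
  "fob (comp_functor G F) X = fob G (fob F X)" "fhom (comp_functor G F) f = fhom G (fhom F f)"
  unfolding comp_functor_def by simp_all

lemma comp_additive_functor:
  assumes "additive_functor A B F" "additive_functor B C G"
  shows "additive_functor A C (comp_functor G F)"
proof -
  have F: "is_functor A B F" and G: "is_functor B C G" using assms additive_functor_def by blast+
  show ?thesis
    unfolding additive_functor_def is_functor_def comp_functor_simps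
  proof (intro conjI allI ballI)
    fix X Y Z f g
    { assume "X \<in> Ob A"
      then show "fob G (fob F X) \<in> Ob C" "fhom G (fhom F (Id A X)) = Id C (fob G (fob F X))"
        using F G functor_Ob functor_Id by metis+ }
    { assume f: "f \<in> Hom A X Y"
      note Ff = functor_Hom[OF F f]
      show "fhom G (fhom F f) \<in> Hom C (fob G (fob F X)) (fob G (fob F Y))"
        using functor_Hom[OF G Ff] .
      { assume g: "g \<in> Hom A Y Z"
        show "fhom G (fhom F (g \<cdot>\<^bsub>A\<^esub> f)) = fhom G (fhom F g) \<cdot>\<^bsub>C\<^esub> fhom G (fhom F f)"
          using functor_Comp[OF F f g] functor_Comp[OF G Ff functor_Hom[OF F g]] by simp }
      { assume g: "g \<in> Hom A X Y"
        show "fhom G (fhom F (f \<boxplus>\<^bsub>A\<^esub> g)) = fhom G (fhom F f) \<boxplus>\<^bsub>C\<^esub> fhom G (fhom F g)"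
          using additive_functor_Add[OF assms(1) f g]
            additive_functor_Add[OF assms(2) Ff functor_Hom[OF F g]] by simp } }
  qed
qed

lemma comp_full_functor:
  assumes "is_functor A B F" "full_functor A B F" "full_functor B C G"
  shows "full_functor A C (comp_functor G F)"
  unfolding full_functor_def comp_functor_simps
proof (intro ballI)
  fix X Y h assume X: "X \<in> Ob A" "Y \<in> Ob A" and "h \<in> Hom C (fob G (fob F X)) (fob G (fob F Y))"
  then obtain g where "g \<in> Hom B (fob F X) (fob F Y)" "fhom G g = h"
    using assms(3) functor_Ob[OF assms(1)] unfolding full_functor_def by blast
  then show "\<exists>f\<in>Hom A X Y. fhom G (fhom F f) = h"
    using assms(2) X unfolding full_functor_def by metis
qed

lemma comp_dense_functor:
  assumes "preadditive_category B" "preadditive_category C" "is_functor B C G"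
    and "dense_functor A B F" "dense_functor B C G"
  shows "dense_functor A C (comp_functor G F)"
  unfolding dense_functor_def comp_functor_simps
proof
  fix Z assume "Z \<in> Ob C"
  then obtain Y g where Y: "Y \<in> Ob B" "is_iso C (fob G Y) Z g"
    using assms(5) unfolding dense_functor_def isomorphic_def by blast
  then obtain X f where X: "X \<in> Ob A" "is_iso B (fob F X) Y f"
    using assms(4) unfolding dense_functor_def isomorphic_def by blast
  have "is_iso C (fob G (fob F X)) Z (g \<cdot>\<^bsub>C\<^esub> fhom G f)"
    using preadditive_category.is_iso_Comp[OF assms(2) functor_is_iso[OF assms(3,1) X(2)] Y(2)] .
  then show "\<exists>X\<in>Ob A. isomorphic C (fob G (fob F X)) Z"
    unfolding isomorphic_def using X by blast
qed

text \<open>A test morphism from \<open>W\<close> becomes one from \<open>F W\<close>. The unique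
  factorization in \<open>B\<close> runs between images of objects of \<open>A\<close>, so it lifts,
  and faithfulness carries equations and uniqueness back.\<close>

lemma full_faithful_reflects_kernel:
  assumes A: "preadditive_category A" and B: "preadditive_category B" and F: "additive_functor A B F"
    and full: "full_functor A B F" and faith: "faithful_functor A B F"
    and i: "i \<in> Hom A X Y" and p: "p \<in> Hom A Y Z"
    and k: "is_kernel B (fob F X) (fob F Y) (fob F Z) (fhom F i) (fhom F p)"
  shows "is_kernel A X Y Z i p"
proof -
  interpret A: preadditive_category A by fact
  interpret B: preadditive_category B by fact
  have F': "is_functor A B F" using F additive_functor_def by blast
  have O: "X \<in> Ob A" "Y \<in> Ob A" "Z \<in> Ob A" using i p A.Hom_Ob by auto
  have "fhom F (p \<cdot>\<^bsub>A\<^esub> i) = fhom F (Zero A X Z)"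
    using k functor_Comp[OF F' i p] additive_functor_Zero[OF A B F O(1,3)]
    unfolding is_kernel_def by simp
  then have "p \<cdot>\<^bsub>A\<^esub> i = Zero A X Z"
    using faithfulD[OF faith A.Comp_Hom[OF i p]] A.Zero_Hom O by blast
  moreover have "\<exists>!g. g \<in> Hom A W X \<and> i \<cdot>\<^bsub>A\<^esub> g = f"
    if f: "f \<in> Hom A W Y" "p \<cdot>\<^bsub>A\<^esub> f = Zero A W Z" for W f
  proof -
    have W: "W \<in> Ob A" using f A.Hom_Ob by blast
    have "fhom F p \<cdot>\<^bsub>B\<^esub> fhom F f = Zero B (fob F W) (fob F Z)"
      using functor_Comp[OF F' f(1) p] f(2) additive_functor_Zero[OF A B F W O(3)] by simp
    then have ex: "\<exists>!g. g \<in> Hom B (fob F W) (fob F X) \<and> fhom F i \<cdot>\<^bsub>B\<^esub> g = fhom F f"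
      using k functor_Hom[OF F' f(1)] unfolding is_kernel_def by blast
    then obtain g where g: "g \<in> Hom A W X" "fhom F i \<cdot>\<^bsub>B\<^esub> fhom F g = fhom F f"
      using full W O unfolding full_functor_def by metis
    have "i \<cdot>\<^bsub>A\<^esub> g = f"
      using faithfulD[OF faith A.Comp_Hom[OF g(1) i] f(1)] functor_Comp[OF F' g(1) i] g(2) by simp
    moreover have "h = g" if h: "h \<in> Hom A W X" "i \<cdot>\<^bsub>A\<^esub> h = f" for h
    proof -
      have "fhom F i \<cdot>\<^bsub>B\<^esub> fhom F h = fhom F f" using functor_Comp[OF F' h(1) i] h(2) by simp
      then have "fhom F h = fhom F g"
        using ex g functor_Hom[OF F' h(1)] functor_Hom[OF F' g(1)] by blast
      then show ?thesis using faithfulD[OF faith h(1) g(1)] by blast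
    qed
    ultimately show ?thesis using g(1) by blast
  qed
  ultimately show ?thesis unfolding is_kernel_def using i p by blast
qed

lemma full_faithful_reflects_cokernel:
  assumes A: "preadditive_category A" and B: "preadditive_category B" and F: "additive_functor A B F"
    and full: "full_functor A B F" and faith: "faithful_functor A B F"
    and i: "i \<in> Hom A X Y" and p: "p \<in> Hom A Y Z"
    and k: "is_cokernel B (fob F X) (fob F Y) (fob F Z) (fhom F i) (fhom F p)"
  shows "is_cokernel A X Y Z i p"
proof -
  interpret A: preadditive_category A by fact
  interpret B: preadditive_category B by fact
  have F': "is_functor A B F" using F additive_functor_def by blast
  have O: "X \<in> Ob A" "Y \<in> Ob A" "Z \<in> Ob A" using i p A.Hom_Ob by auto
  have "fhom F (p \<cdot>\<^bsub>A\<^esub> i) = fhom F (Zero A X Z)"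
    using k functor_Comp[OF F' i p] additive_functor_Zero[OF A B F O(1,3)]
    unfolding is_cokernel_def by simp
  then have "p \<cdot>\<^bsub>A\<^esub> i = Zero A X Z"
    using faithfulD[OF faith A.Comp_Hom[OF i p]] A.Zero_Hom O by blast
  moreover have "\<exists>!g. g \<in> Hom A Z W \<and> g \<cdot>\<^bsub>A\<^esub> p = f"
    if f: "f \<in> Hom A Y W" "f \<cdot>\<^bsub>A\<^esub> i = Zero A X W" for W f
  proof -
    have W: "W \<in> Ob A" using f A.Hom_Ob by blast
    have "fhom F f \<cdot>\<^bsub>B\<^esub> fhom F i = Zero B (fob F X) (fob F W)"
      using functor_Comp[OF F' i f(1)] f(2) additive_functor_Zero[OF A B F O(1) W] by simp
    then have ex: "\<exists>!g. g \<in> Hom B (fob F Z) (fob F W) \<and> g \<cdot>\<^bsub>B\<^esub> fhom F p = fhom F f"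
      using k functor_Hom[OF F' f(1)] unfolding is_cokernel_def by blast
    then obtain g where g: "g \<in> Hom A Z W" "fhom F g \<cdot>\<^bsub>B\<^esub> fhom F p = fhom F f"
      using full W O unfolding full_functor_def by metis
    have "g \<cdot>\<^bsub>A\<^esub> p = f"
      using faithfulD[OF faith A.Comp_Hom[OF p g(1)] f(1)] functor_Comp[OF F' p g(1)] g(2) by simp
    moreover have "h = g" if h: "h \<in> Hom A Z W" "h \<cdot>\<^bsub>A\<^esub> p = f" for h
    proof -
      have "fhom F h \<cdot>\<^bsub>B\<^esub> fhom F p = fhom F f" using functor_Comp[OF F' p h(1)] h(2) by simp
      then have "fhom F h = fhom F g"
        using ex g functor_Hom[OF F' h(1)] functor_Hom[OF F' g(1)] by blast
      then show ?thesis using faithfulD[OF faith h(1) g(1)] by blast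
    qed
    ultimately show ?thesis using g(1) by blast
  qed
  ultimately show ?thesis unfolding is_cokernel_def using i p by blast
qed

section \<open>Factor categories\<close>

text \<open>Operations in \<open>factor_category\<close> are unions of cosets over representatives;
  if these cosets all coincide and both index sets are inhabited, the union is the common
  coset.\<close>

lemma UN_UN_eq:
  assumes "a \<in> T" "b \<in> U" "\<And>x y. x \<in> T \<Longrightarrow> y \<in> U \<Longrightarrow> H x y = c"
  shows "(\<Union>x \<in> T. \<Union>y \<in> U. H x y) = c"
proof -
  have "(\<Union>x \<in> T. \<Union>y \<in> U. H x y) = (\<Union>x \<in> T. \<Union>y \<in> U. c)" using assms(3) by simp
  also have "\<dots> = c" using assms(1,2) by blast
  finally show ?thesis .
qed

text \<open>Serves both for removable subcategories and, with \<open>S\<close> the projectives, for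
  stable categories.\<close>

locale additive_subcategory = preadditive_category C for C :: "('o, 'm) cat" (structure) +
  fixes S :: "'o set"
  assumes full_additive: "full_additive_subcategory C S"
begin

abbreviation "D \<equiv> factor_category C S"
abbreviation "I \<equiv> factor_ideal C S"
abbreviation "cl \<equiv> factor_class C S"

lemma ideal_Hom: "f \<in> I X Y \<Longrightarrow> f \<in> Hom C X Y"
  unfolding factor_ideal_def using Comp_Hom by blast

lemma idealI: "Z \<in> S \<Longrightarrow> f \<in> Hom C X Z \<Longrightarrow> g \<in> Hom C Z Y \<Longrightarrow> g \<cdot> f \<in> I X Y"
  unfolding factor_ideal_def by blast

lemma idealE:
  assumes "f \<in> I X Y"
  obtains Z u v where "Z \<in> S" "u \<in> Hom C X Z" "v \<in> Hom C Z Y" "f = v \<cdot> u"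
  using assms unfolding factor_ideal_def by blast

lemma ideal_Zero:
  assumes "X \<in> Ob C" "Y \<in> Ob C"
  shows "Zero C X Y \<in> I X Y"
proof -
  obtain Z where Z: "Z \<in> S" "Z \<in> Ob C"
    using full_additive unfolding full_additive_subcategory_def by blast
  show ?thesis
    using idealI[OF Z(1) Zero_Hom Zero_Hom] assms Z Comp_Zero[OF Zero_Hom] by metis
qed

lemma ideal_Comp_left:
  assumes "f \<in> I X Y" "g \<in> Hom C Y Z"
  shows "g \<cdot> f \<in> I X Z"
proof -
  obtain W u v where "W \<in> S" "u \<in> Hom C X W" "v \<in> Hom C W Y" "f = v \<cdot> u"
    using idealE[OF assms(1)] .
  then show ?thesis
    using idealI[of W u X "g \<cdot> v"] Comp_Hom[OF _ assms(2)] Comp_assoc[OF _ _ assms(2)] by metis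
qed

lemma ideal_Comp_right:
  assumes "f \<in> Hom C X Y" "g \<in> I Y Z"
  shows "g \<cdot> f \<in> I X Z"
proof -
  obtain W u v where "W \<in> S" "u \<in> Hom C Y W" "v \<in> Hom C W Z" "g = v \<cdot> u"
    using idealE[OF assms(2)] .
  then show ?thesis
    using idealI[of W "u \<cdot> f"] Comp_Hom[OF assms(1)] Comp_assoc[OF assms(1)] by metis
qed

text \<open>Morphisms through \<open>U\<close> and \<open>U'\<close> add up to one through their
  biproduct \<open>W\<close>: the map \<open>s\<close> into \<open>W\<close> has components
  \<open>u\<close> and \<open>u'\<close>, the map out of \<open>W\<close> has components
  \<open>v\<close> and \<open>v'\<close>. Closure of \<open>S\<close> under biproducts enters
  here.\<close>

lemma ideal_Add:
  assumes "f \<in> I X Y" "g \<in> I X Y"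
  shows "f \<boxplus> g \<in> I X Y"
proof -
  obtain U u v where f: "U \<in> S" "u \<in> Hom C X U" "v \<in> Hom C U Y" "f = v \<cdot> u"
    using idealE[OF assms(1)] .
  obtain U' u' v' where g: "U' \<in> S" "u' \<in> Hom C X U'" "v' \<in> Hom C U' Y" "g = v' \<cdot> u'"
    using idealE[OF assms(2)] .
  obtain W i j p q where W: "W \<in> S" "i \<in> Hom C U W" "j \<in> Hom C U' W" "p \<in> Hom C W U" "q \<in> Hom C W U'"
    and b: "p \<cdot> i = Id C U" "q \<cdot> j = Id C U'" "p \<cdot> j = Zero C U' U" "q \<cdot> i = Zero C U U'"
    using full_additive f(1) g(1) unfolding full_additive_subcategory_def biproduct_def by meson
  define s where "s = (i \<cdot> u) \<boxplus> (j \<cdot> u')"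
  have iu: "i \<cdot> u \<in> Hom C X W" and ju: "j \<cdot> u' \<in> Hom C X W"
    using Comp_Hom f g W by blast+
  then have s: "s \<in> Hom C X W" unfolding s_def using Add_Hom by blast
  have "X \<in> Ob C" using f(2) Hom_Ob by blast
  note O = this Hom_Ob[OF f(2), THEN conjunct2] Hom_Ob[OF g(2), THEN conjunct2]
  have "p \<cdot> s = u"
    unfolding s_def
    using Comp_Add[OF iu ju W(4)] Comp_assoc[OF f(2) W(2,4)] Comp_assoc[OF g(2) W(3,4)] b
      Id_Comp[OF f(2)] Zero_Comp[OF g(2) O(2)] Add_Zero[OF f(2)] by simp
  moreover have "q \<cdot> s = u'"
    unfolding s_def
    using Comp_Add[OF iu ju W(5)] Comp_assoc[OF f(2) W(2,5)] Comp_assoc[OF g(2) W(3,5)] b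
      Id_Comp[OF g(2)] Zero_Comp[OF f(2) O(3)] Zero_Add[OF g(2)] by simp
  moreover have vp: "v \<cdot> p \<in> Hom C W Y" "v' \<cdot> q \<in> Hom C W Y"
    using Comp_Hom f g W by blast+
  ultimately have "((v \<cdot> p) \<boxplus> (v' \<cdot> q)) \<cdot> s = f \<boxplus> g"
    using Add_Comp[OF s vp] Comp_assoc[OF s W(4) f(3)] Comp_assoc[OF s W(5) g(3)] f(4) g(4) by simp
  then show ?thesis using idealI[OF W(1) s Add_Hom[OF vp]] by simp
qed

lemma ideal_negative:
  assumes "f \<in> I X Y" "g \<in> Hom C X Y" "f \<boxplus> g = Zero C X Y"
  shows "g \<in> I X Y"
proof -
  obtain Z u v where f: "Z \<in> S" "u \<in> Hom C X Z" "v \<in> Hom C Z Y" "f = v \<cdot> u"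
    using idealE[OF assms(1)] .
  obtain v' where v': "v' \<in> Hom C Z Y" "v \<boxplus> v' = Zero C Z Y" using ex_negative[OF f(3)] by blast
  have "f \<boxplus> (v' \<cdot> u) = f \<boxplus> g"
    using Add_Comp[OF f(2,3) v'(1)] v'(2) f(4) assms(3) Zero_Comp[OF f(2)] Hom_Ob[OF f(3)] by simp
  then have "v' \<cdot> u = g"
    using Add_left_cancel ideal_Hom[OF assms(1)] Comp_Hom[OF f(2) v'(1)] assms(2) by blast
  then show ?thesis using idealI[OF f(1,2) v'(1)] by simp
qed

lemma classI: "f \<in> Hom C X Y \<Longrightarrow> d \<in> I X Y \<Longrightarrow> f \<boxplus> d \<in> cl f"
  unfolding factor_class_def by blast

lemma classE:
  assumes "h \<in> cl f" "f \<in> Hom C X Y"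
  obtains d where "d \<in> I X Y" "h = f \<boxplus> d"
proof -
  obtain d X' Y' where "f \<in> Hom C X' Y'" "d \<in> I X' Y'" "h = f \<boxplus> d"
    using assms(1) unfolding factor_class_def by blast
  then show ?thesis using that Hom_disjoint[OF assms(2)] by metis
qed

lemma class_self:
  assumes "f \<in> Hom C X Y" shows "f \<in> cl f"
  using classI[OF assms ideal_Zero] Add_Zero[OF assms] Hom_Ob[OF assms] by simp

lemma class_Hom:
  assumes "f \<in> Hom C X Y" "h \<in> cl f" shows "h \<in> Hom C X Y"
proof -
  obtain d where "d \<in> I X Y" "h = f \<boxplus> d" using classE[OF assms(2,1)] .
  then show ?thesis using Add_Hom[OF assms(1) ideal_Hom] by simp
qed

text \<open>The ideal is closed under sums and negatives, so translation by \<open>d\<close> maps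
  the coset onto itself.\<close>

lemma class_Add_ideal:
  assumes f: "f \<in> Hom C X Y" and d: "d \<in> I X Y"
  shows "cl (f \<boxplus> d) = cl f"
proof -
  note dH = ideal_Hom[OF d]
  note fd = Add_Hom[OF f dH]
  obtain k where k: "k \<in> Hom C X Y" "d \<boxplus> k = Zero C X Y" using ex_negative[OF dH] by blast
  have kI: "k \<in> I X Y" using ideal_negative[OF d k] .
  have "h \<in> cl f" if h: "h \<in> cl (f \<boxplus> d)" for h
  proof -
    obtain e where e: "e \<in> I X Y" "h = (f \<boxplus> d) \<boxplus> e" using classE[OF h fd] .
    then have "h = f \<boxplus> (d \<boxplus> e)" using Add_assoc[OF f dH ideal_Hom[OF e(1)]] by simp
    then show ?thesis using classI[OF f ideal_Add[OF d e(1)]] by simp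
  qed
  moreover have "h \<in> cl (f \<boxplus> d)" if h: "h \<in> cl f" for h
  proof -
    obtain e where e: "e \<in> I X Y" "h = f \<boxplus> e" using classE[OF h f] .
    note eH = ideal_Hom[OF e(1)]
    have "(f \<boxplus> d) \<boxplus> (k \<boxplus> e) = f \<boxplus> ((d \<boxplus> k) \<boxplus> e)"
      using Add_assoc[OF f dH Add_Hom[OF k(1) eH]] Add_assoc[OF dH k(1) eH] by simp
    then have "h = (f \<boxplus> d) \<boxplus> (k \<boxplus> e)" using k(2) Zero_Add[OF eH] e(2) by simp
    then show ?thesis using classI[OF fd ideal_Add[OF kI e(1)]] by simp
  qed
  ultimately show ?thesis by blast
qed

lemma class_eq_Zero_iff:
  assumes "f \<in> Hom C X Y"
  shows "cl f = cl (Zero C X Y) \<longleftrightarrow> f \<in> I X Y"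
proof
  note z = Zero_Hom[OF Hom_Ob[OF assms, THEN conjunct1] Hom_Ob[OF assms, THEN conjunct2]]
  assume "cl f = cl (Zero C X Y)"
  then obtain d where "d \<in> I X Y" "f = Zero C X Y \<boxplus> d"
    using classE[OF _ z] class_self[OF assms] by metis
  then show "f \<in> I X Y" using Zero_Add[OF ideal_Hom] by simp
next
  note z = Zero_Hom[OF Hom_Ob[OF assms, THEN conjunct1] Hom_Ob[OF assms, THEN conjunct2]]
  assume "f \<in> I X Y"
  then show "cl f = cl (Zero C X Y)"
    using class_Add_ideal[OF z] Zero_Add[OF assms] by metis
qed

section \<open>Composition and addition of cosets\<close>

lemma factor_simps:
  "Ob D = Ob C" "Hom D X Y = cl ` Hom C X Y" "Id D X = cl (Id C X)" "Zero D X Y = cl (Zero C X Y)"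
  unfolding factor_category_def by simp_all

lemma Comp_class:
  assumes f: "f \<in> Hom C X Y" and g: "g \<in> Hom C Y Z"
  shows "cl g \<cdot>\<^bsub>D\<^esub> cl f = cl (g \<cdot> f)"
proof -
  have "cl (g' \<cdot> f') = cl (g \<cdot> f)" if g': "g' \<in> cl g" and f': "f' \<in> cl f" for g' f'
  proof -
    obtain d where d: "d \<in> I Y Z" "g' = g \<boxplus> d" using classE[OF g' g] .
    obtain e where e: "e \<in> I X Y" "f' = f \<boxplus> e" using classE[OF f' f] .
    note gH = class_Hom[OF g g']
    \<comment> \<open>The product is expanded without splitting \<open>g' \<cdot> e\<close>, which
      already lies in the ideal; the two correction terms are then removed one after the
      other.\<close>
    have "g' \<cdot> f' = ((g \<cdot> f) \<boxplus> (d \<cdot> f)) \<boxplus> (g' \<cdot> e)"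
      using Comp_Add[OF f ideal_Hom[OF e(1)] gH] Add_Comp[OF f g ideal_Hom[OF d(1)]] d(2) e(2) by simp
    then show ?thesis
      using class_Add_ideal[OF Comp_Hom[OF f g] ideal_Comp_right[OF f d(1)]]
        class_Add_ideal[OF Add_Hom[OF Comp_Hom[OF f g] ideal_Hom[OF ideal_Comp_right[OF f d(1)]]]
          ideal_Comp_left[OF e(1) gH]] by simp
  qed
  then have "(\<Union>g' \<in> cl g. \<Union>f' \<in> cl f. cl (g' \<cdot> f')) = cl (g \<cdot> f)"
    by (rule UN_UN_eq[OF class_self[OF g] class_self[OF f]])
  then show ?thesis unfolding factor_category_def by simp
qed

lemma Add_class:
  assumes f: "f \<in> Hom C X Y" and g: "g \<in> Hom C X Y"
  shows "cl f \<boxplus>\<^bsub>D\<^esub> cl g = cl (f \<boxplus> g)"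
proof -
  have "cl (f' \<boxplus> g') = cl (f \<boxplus> g)" if g': "g' \<in> cl g" and f': "f' \<in> cl f" for g' f'
  proof -
    obtain d where d: "d \<in> I X Y" "g' = g \<boxplus> d" using classE[OF g' g] .
    obtain e where e: "e \<in> I X Y" "f' = f \<boxplus> e" using classE[OF f' f] .
    note dH = ideal_Hom[OF d(1)] and eH = ideal_Hom[OF e(1)]
    have "f' \<boxplus> g' = f \<boxplus> ((g \<boxplus> d) \<boxplus> e)"
      using Add_assoc[OF f eH Add_Hom[OF g dH]] Add_commute[OF eH Add_Hom[OF g dH]] d(2) e(2) by simp
    also have "\<dots> = (f \<boxplus> g) \<boxplus> (d \<boxplus> e)"
      using Add_assoc[OF g dH eH] Add_assoc[OF f g Add_Hom[OF dH eH]] by simp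
    finally show ?thesis
      using class_Add_ideal[OF Add_Hom[OF f g] ideal_Add[OF d(1) e(1)]] by simp
  qed
  then have "(\<Union>f' \<in> cl f. \<Union>g' \<in> cl g. cl (f' \<boxplus> g')) = cl (f \<boxplus> g)"
    by (rule UN_UN_eq[OF class_self[OF f] class_self[OF g]])
  then show ?thesis unfolding factor_category_def by simp
qed

lemma preadditive_factor: "preadditive_category D"
proof (rule preadditive_category.intro)
  fix X Y Z W X' Y' f f' g g' h
  { assume "f \<in> Hom D X Y"
    then obtain a where a: "a \<in> Hom C X Y" "f = cl a" unfolding factor_simps by blast
    show "X \<in> Ob D \<and> Y \<in> Ob D" unfolding factor_simps using a Hom_Ob by blast
    show "f \<cdot>\<^bsub>D\<^esub> Id D X = f" "Id D Y \<cdot>\<^bsub>D\<^esub> f = f"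
      unfolding factor_simps
      using a Comp_class Id_Hom Hom_Ob Comp_Id Id_Comp by metis+
    { assume "f \<in> Hom D X' Y'"
      then obtain b where b: "b \<in> Hom C X' Y'" "f = cl b" unfolding factor_simps by blast
      \<comment> \<open>Disjointness passes to cosets because a coset contains its representative
        and stays inside one hom-set.\<close>
      have "a \<in> Hom C X' Y'" using class_Hom[OF b(1)] class_self[OF a(1)] a b by simp
      then show "X = X' \<and> Y = Y'" using Hom_disjoint a by blast }
    { assume "g \<in> Hom D Y Z"
      then obtain b where b: "b \<in> Hom C Y Z" "g = cl b" unfolding factor_simps by blast
      then show "g \<cdot>\<^bsub>D\<^esub> f \<in> Hom D X Z"
        using a Comp_class Comp_Hom unfolding factor_simps by blast
      { assume "f' \<in> Hom D X Y"
        then obtain a' where a': "a' \<in> Hom C X Y" "f' = cl a'" unfolding factor_simps by blast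
        show "g \<cdot>\<^bsub>D\<^esub> (f \<boxplus>\<^bsub>D\<^esub> f') = (g \<cdot>\<^bsub>D\<^esub> f) \<boxplus>\<^bsub>D\<^esub> (g \<cdot>\<^bsub>D\<^esub> f')"
          using Add_class[OF a(1) a'(1)] Comp_class[OF Add_Hom[OF a(1) a'(1)] b(1)]
            Comp_class[OF a(1) b(1)] Comp_class[OF a'(1) b(1)]
            Add_class[OF Comp_Hom[OF a(1) b(1)] Comp_Hom[OF a'(1) b(1)]]
            Comp_Add[OF a(1) a'(1) b(1)] a a' b by simp }
      { assume "g' \<in> Hom D Y Z"
        then obtain b' where b': "b' \<in> Hom C Y Z" "g' = cl b'" unfolding factor_simps by blast
        show "(g \<boxplus>\<^bsub>D\<^esub> g') \<cdot>\<^bsub>D\<^esub> f = (g \<cdot>\<^bsub>D\<^esub> f) \<boxplus>\<^bsub>D\<^esub> (g' \<cdot>\<^bsub>D\<^esub> f)"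
          using Add_class[OF b(1) b'(1)] Comp_class[OF a(1) Add_Hom[OF b(1) b'(1)]]
            Comp_class[OF a(1) b(1)] Comp_class[OF a(1) b'(1)]
            Add_class[OF Comp_Hom[OF a(1) b(1)] Comp_Hom[OF a(1) b'(1)]]
            Add_Comp[OF a(1) b(1) b'(1)] a b b' by simp } } }
  { assume "f \<in> Hom D W X" "g \<in> Hom D X Y" "h \<in> Hom D Y Z"
    then obtain a b c where abc: "a \<in> Hom C W X" "b \<in> Hom C X Y" "c \<in> Hom C Y Z"
      and eq: "f = cl a" "g = cl b" "h = cl c" unfolding factor_simps by blast
    show "h \<cdot>\<^bsub>D\<^esub> (g \<cdot>\<^bsub>D\<^esub> f) = (h \<cdot>\<^bsub>D\<^esub> g) \<cdot>\<^bsub>D\<^esub> f"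
      unfolding eq using Comp_class[OF abc(1,2)] Comp_class[OF abc(2,3)]
        Comp_class[OF Comp_Hom[OF abc(1,2)] abc(3)] Comp_class[OF abc(1) Comp_Hom[OF abc(2,3)]]
        Comp_assoc[OF abc] by simp }
  { assume "X \<in> Ob D"
    then show "Id D X \<in> Hom D X X" unfolding factor_simps using Id_Hom by blast }
  { assume "X \<in> Ob D" "Y \<in> Ob D"
    then have O: "X \<in> Ob C" "Y \<in> Ob C" unfolding factor_simps by auto
    show "comm_group (hom_group D X Y)"
    proof (rule comm_groupI; unfold hom_group_def partial_object.simps monoid.simps factor_simps(2,4))
      show "cl (Zero C X Y) \<in> cl ` Hom C X Y" using Zero_Hom O by blast
      fix x assume "x \<in> cl ` Hom C X Y"
      then obtain a where a: "a \<in> Hom C X Y" "x = cl a" by blast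
      show "cl (Zero C X Y) \<boxplus>\<^bsub>D\<^esub> x = x"
        using Add_class[OF Zero_Hom[OF O] a(1)] Zero_Add[OF a(1)] a(2) by simp
      obtain k where "k \<in> Hom C X Y" "a \<boxplus> k = Zero C X Y" using ex_negative[OF a(1)] by blast
      then show "\<exists>y\<in>cl ` Hom C X Y. y \<boxplus>\<^bsub>D\<^esub> x = cl (Zero C X Y)"
        using Add_class[of k X Y a] Add_commute[of a X Y k] a by auto
      fix y assume "y \<in> cl ` Hom C X Y"
      then obtain b where b: "b \<in> Hom C X Y" "y = cl b" by blast
      show "x \<boxplus>\<^bsub>D\<^esub> y \<in> cl ` Hom C X Y" using a b Add_class Add_Hom by blast
      show "x \<boxplus>\<^bsub>D\<^esub> y = y \<boxplus>\<^bsub>D\<^esub> x" using a b Add_class Add_commute by metis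
      fix z assume "z \<in> cl ` Hom C X Y"
      then obtain c where c: "c \<in> Hom C X Y" "z = cl c" by blast
      show "x \<boxplus>\<^bsub>D\<^esub> y \<boxplus>\<^bsub>D\<^esub> z = x \<boxplus>\<^bsub>D\<^esub> (y \<boxplus>\<^bsub>D\<^esub> z)"
        using Add_class[OF a(1) b(1)] Add_class[OF b(1) c(1)] Add_class[OF Add_Hom[OF a(1) b(1)] c(1)]
          Add_class[OF a(1) Add_Hom[OF b(1) c(1)]] Add_assoc[OF a(1) b(1) c(1)] a b c by simp
    qed }
qed

section \<open>The projection and functors out of the factor category\<close>

lemma factor_functor_simps [simp]:
  "fob (factor_functor C S) X = X" "fhom (factor_functor C S) f = cl f"
  unfolding factor_functor_def by simp_all

lemma factor_functor_additive: "additive_functor C D (factor_functor C S)"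
  unfolding additive_functor_def is_functor_def
  using Comp_class Add_class by (auto simp: factor_simps)

lemma factor_functor_full: "full_functor C D (factor_functor C S)"
  unfolding full_functor_def by (auto simp: factor_simps)

lemma factor_functor_dense: "dense_functor C D (factor_functor C S)"
  unfolding dense_functor_def isomorphic_def
  using preadditive_category.is_iso_Id[OF preadditive_factor] by (auto simp: factor_simps)

text \<open>Universal property of the factor category. \<open>H\<close> is described only by its
  values on cosets of morphisms, so one lemma covers both \<open>stable_functor\<close>, defined by
  a union, and the functor induced by \<open>F\<close>, defined by a choice of
  representatives.\<close>

lemma factor_additive_functorI:
  assumes K: "additive_functor C B K"
    and ob: "\<And>X. fob H X = fob K X"
    and hom: "\<And>X Y f. f \<in> Hom C X Y \<Longrightarrow> fhom H (cl f) = fhom K f"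
  shows "additive_functor D B H"
proof -
  have Kf: "is_functor C B K" using K additive_functor_def by blast
  show ?thesis
    unfolding additive_functor_def is_functor_def ob
  proof (intro conjI allI ballI)
    fix X Y Z f g
    { assume "X \<in> Ob D"
      then have "X \<in> Ob C" unfolding factor_simps .
      then show "fob K X \<in> Ob B" "fhom H (Id D X) = Id B (fob K X)"
        unfolding factor_simps using functor_Ob[OF Kf] functor_Id[OF Kf] hom[OF Id_Hom] by simp_all }
    { assume "f \<in> Hom D X Y"
      then obtain a where a: "a \<in> Hom C X Y" "f = cl a" unfolding factor_simps by blast
      show "fhom H f \<in> Hom B (fob K X) (fob K Y)"
        using functor_Hom[OF Kf a(1)] hom[OF a(1)] a(2) by simp
      { assume "g \<in> Hom D Y Z"
        then obtain b where b: "b \<in> Hom C Y Z" "g = cl b" unfolding factor_simps by blast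
        show "fhom H (g \<cdot>\<^bsub>D\<^esub> f) = fhom H g \<cdot>\<^bsub>B\<^esub> fhom H f"
          using Comp_class[OF a(1) b(1)] hom[OF Comp_Hom[OF a(1) b(1)]] hom[OF a(1)] hom[OF b(1)]
            functor_Comp[OF Kf a(1) b(1)] a(2) b(2) by simp }
      { assume "g \<in> Hom D X Y"
        then obtain b where b: "b \<in> Hom C X Y" "g = cl b" unfolding factor_simps by blast
        show "fhom H (f \<boxplus>\<^bsub>D\<^esub> g) = fhom H f \<boxplus>\<^bsub>B\<^esub> fhom H g"
          using Add_class[OF a(1) b(1)] hom[OF Add_Hom[OF a(1) b(1)]] hom[OF a(1)] hom[OF b(1)]
            additive_functor_Add[OF K a(1) b(1)] a(2) b(2) by simp } }
  qed
qed

lemma factor_full_functorI: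
  assumes "full_functor C B K"
    and ob: "\<And>X. fob H X = fob K X"
    and hom: "\<And>X Y f. f \<in> Hom C X Y \<Longrightarrow> fhom H (cl f) = fhom K f"
  shows "full_functor D B H"
  unfolding full_functor_def ob factor_simps
proof (intro ballI)
  fix X Y g assume "X \<in> Ob C" "Y \<in> Ob C" "g \<in> Hom B (fob K X) (fob K Y)"
  then obtain f where "f \<in> Hom C X Y" "fhom K f = g"
    using assms(1) unfolding full_functor_def by blast
  then show "\<exists>f\<in>cl ` Hom C X Y. fhom H f = g" using hom by blast
qed

lemma factor_dense_functorI:
  assumes "dense_functor C B K" and ob: "\<And>X. fob H X = fob K X"
  shows "dense_functor D B H"
  using assms(1) unfolding dense_functor_def ob factor_simps .

end

section \<open>Exact categories\<close>

context additive_category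
begin

text \<open>Maps out of a zero object are zero, and a lift from a biproduct is assembled from lifts
  on its summands. This makes the stable category an instance of the factor construction.\<close>

lemma projectives_full_additive: "full_additive_subcategory C (projectives C E)"
  unfolding full_additive_subcategory_def
proof (intro conjI ballI)
  show "projectives C E \<subseteq> Ob C" unfolding projectives_def by blast
  obtain Z where Z: "zero_object C Z" using ex_zero_object by blast
  have "\<exists>g \<in> Hom C Z Y. p \<cdot> g = f" if "p \<in> Hom C Y W" "f \<in> Hom C Z W" for Y W p f
  proof -
    have O: "Z \<in> Ob C" "Y \<in> Ob C" using Z that Hom_Ob zero_object_def by metis+
    have "p \<cdot> Zero C Z Y \<in> Hom C Z W" using Comp_Hom Zero_Hom O that by blast
    then have "p \<cdot> Zero C Z Y = f"
      using Z that Hom_Ob unfolding zero_object_def by metis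
    then show ?thesis using Zero_Hom[OF O] by blast
  qed
  then have "Z \<in> projectives C E"
    unfolding projectives_def using Z zero_object_def[of C Z] by blast
  then show "\<exists>Z\<in>projectives C E. zero_object C Z" using Z by blast
next
  fix X Y assume X: "X \<in> projectives C E" and Y: "Y \<in> projectives C E"
  then obtain S where S: "biproduct C X Y S" using ex_biproduct unfolding projectives_def by blast
  then obtain i j p q where b: "i \<in> Hom C X S" "j \<in> Hom C Y S" "p \<in> Hom C S X" "q \<in> Hom C S Y"
    "(i \<cdot> p) \<boxplus> (j \<cdot> q) = Id C S"
    unfolding biproduct_def by blast
  have "\<exists>g \<in> Hom C S U. r \<cdot> g = f" if r: "r \<in> Hom C U V" "deflation E r" and f: "f \<in> Hom C S V" for U V r f
  proof -
    note fi = Comp_Hom[OF b(1) f] and fj = Comp_Hom[OF b(2) f]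
    obtain g where g: "g \<in> Hom C X U" "r \<cdot> g = f \<cdot> i"
      using X r fi unfolding projectives_def by blast
    obtain h where h: "h \<in> Hom C Y U" "r \<cdot> h = f \<cdot> j"
      using Y r fj unfolding projectives_def by blast
    note gp = Comp_Hom[OF b(3) g(1)] and hq = Comp_Hom[OF b(4) h(1)]
    have "r \<cdot> ((g \<cdot> p) \<boxplus> (h \<cdot> q)) = (f \<cdot> (i \<cdot> p)) \<boxplus> (f \<cdot> (j \<cdot> q))"
      using Comp_Add[OF gp hq r(1)] Comp_assoc[OF b(3) g(1) r(1)] Comp_assoc[OF b(4) h(1) r(1)]
        Comp_assoc[OF b(3,1) f] Comp_assoc[OF b(4,2) f] g(2) h(2) by simp
    also have "\<dots> = f"
      using Comp_Add[OF Comp_Hom[OF b(3,1)] Comp_Hom[OF b(4,2)] f] b(5) Comp_Id[OF f] by simp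
    finally show ?thesis using Add_Hom[OF gp hq] by blast
  qed
  then have "S \<in> projectives C E"
    unfolding projectives_def using Hom_Ob[OF b(1)] by blast
  then show "\<exists>W\<in>projectives C E. biproduct C X Y W" using S by blast
qed

text \<open>Lifting \<open>f \<cdot> r\<close> from \<open>P\<close> and restricting along
  \<open>s\<close> lifts \<open>f\<close>.\<close>

lemma retract_projective:
  assumes P: "P \<in> projectives C E" and s: "s \<in> Hom C X P" and r: "r \<in> Hom C P X"
    and rs: "r \<cdot> s = Id C X"
  shows "X \<in> projectives C E"
proof -
  have "\<exists>g \<in> Hom C X Y. p \<cdot> g = f" if p: "p \<in> Hom C Y Z" "deflation E p" and f: "f \<in> Hom C X Z" for Y Z p f
  proof -
    obtain g where g: "g \<in> Hom C P Y" "p \<cdot> g = f \<cdot> r"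
      using P p Comp_Hom[OF r f] unfolding projectives_def by blast
    have "p \<cdot> (g \<cdot> s) = f"
      using Comp_assoc[OF s g(1) p(1)] g(2) Comp_assoc[OF s r f] rs Comp_Id[OF f] by simp
    then show ?thesis using Comp_Hom[OF s g(1)] by blast
  qed
  then show ?thesis unfolding projectives_def using Hom_Ob[OF s] by blast
qed

end

lemma projectives_lift:
  "P \<in> projectives C E \<Longrightarrow> p \<in> Hom C Y Z \<Longrightarrow> deflation E p \<Longrightarrow> f \<in> Hom C P Z \<Longrightarrow>
    \<exists>g \<in> Hom C P Y. p \<cdot>\<^bsub>C\<^esub> g = f"
  unfolding projectives_def by blast

lemma injectives_extend:
  "I \<in> injectives C E \<Longrightarrow> i \<in> Hom C X Y \<Longrightarrow> inflation E i \<Longrightarrow> f \<in> Hom C X I \<Longrightarrow>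
    \<exists>g \<in> Hom C Y I. g \<cdot>\<^bsub>C\<^esub> i = f"
  unfolding injectives_def by blast

section \<open>Kernels, cokernels and pullbacks\<close>

context preadditive_category
begin

lemma kernel_mono:
  assumes k: "is_kernel C X Y Z i p" and f: "f \<in> Hom C W X" "g \<in> Hom C W X" "i \<cdot> f = i \<cdot> g"
  shows "f = g"
proof -
  have i: "i \<in> Hom C X Y" and p: "p \<in> Hom C Y Z" and pi: "p \<cdot> i = Zero C X Z"
    using k unfolding is_kernel_def by auto
  have "p \<cdot> (i \<cdot> g) = Zero C W Z"
    using Comp_assoc[OF f(2) i p] pi Zero_Comp[OF f(2)] Hom_Ob[OF p] by simp
  then have "\<exists>!h. h \<in> Hom C W X \<and> i \<cdot> h = i \<cdot> g"
    using k Comp_Hom[OF f(2) i] unfolding is_kernel_def by blast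
  then show ?thesis using f by blast
qed

lemma kernel_factor:
  assumes "is_kernel C X Y Z i p" "f \<in> Hom C W Y" "p \<cdot> f = Zero C W Z"
  obtains g where "g \<in> Hom C W X" "i \<cdot> g = f"
  using assms unfolding is_kernel_def by blast

lemma cokernel_epi:
  assumes k: "is_cokernel C X Y Z i p" and f: "f \<in> Hom C Z W" "g \<in> Hom C Z W" "f \<cdot> p = g \<cdot> p"
  shows "f = g"
proof -
  have i: "i \<in> Hom C X Y" and p: "p \<in> Hom C Y Z" and pi: "p \<cdot> i = Zero C X Z"
    using k unfolding is_cokernel_def by auto
  have "(g \<cdot> p) \<cdot> i = Zero C X W"
    using Comp_assoc[OF i p f(2)] pi Comp_Zero[OF f(2)] Hom_Ob[OF i] by simp
  then have "\<exists>!h. h \<in> Hom C Z W \<and> h \<cdot> p = g \<cdot> p"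
    using k Comp_Hom[OF p f(2)] unfolding is_cokernel_def by blast
  then show ?thesis using f by blast
qed

lemma cokernel_factor:
  assumes "is_cokernel C X Y Z i p" "f \<in> Hom C Y W" "f \<cdot> i = Zero C X W"
  obtains g where "g \<in> Hom C Z W" "g \<cdot> p = f"
  using assms unfolding is_cokernel_def by blast

lemma pullback_eq:
  assumes P: "is_pullback C Y Z Y' Z' p f p' f'"
    and u: "u \<in> Hom C W Y'" "v \<in> Hom C W Y'" "f' \<cdot> u = f' \<cdot> v" "p' \<cdot> u = p' \<cdot> v"
  shows "u = v"
proof -
  have H: "p \<in> Hom C Y Z" "f \<in> Hom C Z' Z" "p' \<in> Hom C Y' Z'" "f' \<in> Hom C Y' Y" "p \<cdot> f' = f \<cdot> p'"
    using P unfolding is_pullback_def by auto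
  have "p \<cdot> (f' \<cdot> v) = f \<cdot> (p' \<cdot> v)"
    using Comp_assoc[OF u(2) H(4,1)] Comp_assoc[OF u(2) H(3,2)] H(5) by simp
  then have "\<exists>!w. w \<in> Hom C W Y' \<and> f' \<cdot> w = f' \<cdot> v \<and> p' \<cdot> w = p' \<cdot> v"
    using P Comp_Hom[OF u(2) H(4)] Comp_Hom[OF u(2) H(3)] unfolding is_pullback_def by blast
  then show ?thesis using u by blast
qed

lemma pullback_factor:
  assumes "is_pullback C Y Z Y' Z' p f p' f'" "u \<in> Hom C W Y" "v \<in> Hom C W Z'" "p \<cdot> u = f \<cdot> v"
  obtains w where "w \<in> Hom C W Y'" "f' \<cdot> w = u" "p' \<cdot> w = v"
  using assms unfolding is_pullback_def by blast

lemma pullback_unique: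
  assumes P: "is_pullback C Y Z Y1 Z' p f p1 f1" and Q: "is_pullback C Y Z Y2 Z' p f p2 f2"
  obtains b where "is_iso C Y1 Y2 b" "p2 \<cdot> b = p1" "f2 \<cdot> b = f1"
proof -
  have H: "p1 \<in> Hom C Y1 Z'" "f1 \<in> Hom C Y1 Y" "p \<cdot> f1 = f \<cdot> p1"
    "p2 \<in> Hom C Y2 Z'" "f2 \<in> Hom C Y2 Y" "p \<cdot> f2 = f \<cdot> p2"
    using P Q unfolding is_pullback_def by auto
  obtain b where b: "b \<in> Hom C Y1 Y2" "f2 \<cdot> b = f1" "p2 \<cdot> b = p1"
    using pullback_factor[OF Q H(2,1,3)] .
  obtain a where a: "a \<in> Hom C Y2 Y1" "f1 \<cdot> a = f2" "p1 \<cdot> a = p2"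
    using pullback_factor[OF P H(5,4,6)] .
  have O: "Y1 \<in> Ob C" "Y2 \<in> Ob C" using b Hom_Ob by auto
  have "a \<cdot> b = Id C Y1"
    using pullback_eq[OF P Comp_Hom[OF b(1) a(1)] Id_Hom[OF O(1)]]
      Comp_assoc[OF b(1) a(1) H(1)] Comp_assoc[OF b(1) a(1) H(2)] a b Comp_Id[OF H(1)] Comp_Id[OF H(2)]
    by simp
  moreover have "b \<cdot> a = Id C Y2"
    using pullback_eq[OF Q Comp_Hom[OF a(1) b(1)] Id_Hom[OF O(2)]]
      Comp_assoc[OF a(1) b(1) H(4)] Comp_assoc[OF a(1) b(1) H(5)] a b Comp_Id[OF H(4)] Comp_Id[OF H(5)]
    by simp
  ultimately have "is_iso C Y1 Y2 b" unfolding is_iso_def using a b by blast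
  then show ?thesis using that b by blast
qed

text \<open>The kernel of \<open>p'\<close> is the morphism with components \<open>i\<close> and
  zero. Keeping the object \<open>X\<close> itself lets \<open>f' \<cdot> i' = i\<close> hold
  exactly, as the later comparison of conflations requires.\<close>

lemma pullback_kernel:
  assumes P: "is_pullback C Y Z Y' Z' p f p' f'" and k: "is_kernel C X Y Z i p"
  obtains i' where "is_kernel C X Y' Z' i' p'" "f' \<cdot> i' = i"
proof -
  have H: "p \<in> Hom C Y Z" "f \<in> Hom C Z' Z" "p' \<in> Hom C Y' Z'" "f' \<in> Hom C Y' Y" "p \<cdot> f' = f \<cdot> p'"
    using P unfolding is_pullback_def by auto
  have i: "i \<in> Hom C X Y" "p \<cdot> i = Zero C X Z" using k unfolding is_kernel_def by auto
  have O: "X \<in> Ob C" "Z' \<in> Ob C" "Z \<in> Ob C" using i H Hom_Ob by auto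
  obtain i' where i': "i' \<in> Hom C X Y'" "f' \<cdot> i' = i" "p' \<cdot> i' = Zero C X Z'"
    using pullback_factor[OF P i(1) Zero_Hom[OF O(1,2)]] i(2) Comp_Zero[OF H(2) O(1)] by metis
  have "\<exists>!g. g \<in> Hom C W X \<and> i' \<cdot> g = u" if u: "u \<in> Hom C W Y'" "p' \<cdot> u = Zero C W Z'" for W u
  proof -
    have W: "W \<in> Ob C" using u Hom_Ob by blast
    have "p \<cdot> (f' \<cdot> u) = Zero C W Z"
      using Comp_assoc[OF u(1) H(4,1)] Comp_assoc[OF u(1) H(3,2)] H(5) u(2) Comp_Zero[OF H(2) W] by simp
    then obtain g where g: "g \<in> Hom C W X" "i \<cdot> g = f' \<cdot> u"
      using kernel_factor[OF k Comp_Hom[OF u(1) H(4)]] by blast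
    have "i' \<cdot> g = u"
      using pullback_eq[OF P Comp_Hom[OF g(1) i'(1)] u(1)] Comp_assoc[OF g(1) i'(1) H(4)]
        Comp_assoc[OF g(1) i'(1) H(3)] i' g(2) u(2) Zero_Comp[OF g(1) O(2)] by simp
    moreover have "h = g" if h: "h \<in> Hom C W X" "i' \<cdot> h = u" for h
    proof -
      have "i \<cdot> h = i \<cdot> g"
        using Comp_assoc[OF h(1) i'(1) H(4)] i'(2) h(2) g(2) by simp
      then show ?thesis using kernel_mono[OF k h(1) g(1)] by blast
    qed
    ultimately show ?thesis using g(1) by blast
  qed
  then have "is_kernel C X Y' Z' i' p'" unfolding is_kernel_def using i' H by blast
  then show ?thesis using that i' by blast
qed

end

section \<open>Conflations and their morphisms\<close>

context exact_category
begin

lemma conflationE: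
  assumes "(i, p) \<in> E"
  obtains X Y Z where "i \<in> Hom C X Y" "p \<in> Hom C Y Z" "is_kernel C X Y Z i p" "is_cokernel C X Y Z i p"
  using conflation_pair[OF assms] unfolding kernel_cokernel_pair_def is_kernel_def by blast

lemma conflation_kernel_cokernel:
  assumes "(i, p) \<in> E" "i \<in> Hom C X Y" "p \<in> Hom C Y Z"
  shows "is_kernel C X Y Z i p" "is_cokernel C X Y Z i p"
  using conflationE[OF assms(1)] assms(2,3) Hom_disjoint by metis+

text \<open>A deflation comes with some kernel in \<open>E\<close>; any other kernel is isomorphic
  to it over the same \<open>p\<close>, and \<open>E\<close> is closed under isomorphism of
  pairs.\<close>

lemma kernel_of_deflation:
  assumes p: "deflation E p" and k: "is_kernel C X Y Z i p"
  shows "(i, p) \<in> E"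
proof -
  have ip: "i \<in> Hom C X Y" "p \<in> Hom C Y Z" "p \<cdot> i = Zero C X Z" using k unfolding is_kernel_def by auto
  obtain k where kE: "(k, p) \<in> E" using p unfolding deflation_def by blast
  then obtain K where kH: "k \<in> Hom C K Y" using conflationE ip(2) Hom_disjoint by metis
  note kk = conflation_kernel_cokernel(1)[OF kE kH ip(2)]
  have pk: "p \<cdot> k = Zero C K Z" using kk unfolding is_kernel_def by blast
  obtain a where a: "a \<in> Hom C K X" "i \<cdot> a = k" using kernel_factor[OF k kH pk] .
  obtain b where b: "b \<in> Hom C X K" "k \<cdot> b = i" using kernel_factor[OF kk ip(1,3)] .
  have O: "X \<in> Ob C" "K \<in> Ob C" "Y \<in> Ob C" "Z \<in> Ob C" using Hom_Ob ip kH by auto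
  have "a \<cdot> b = Id C X"
    using kernel_mono[OF k Comp_Hom[OF b(1) a(1)] Id_Hom[OF O(1)]] Comp_assoc[OF b(1) a(1) ip(1)]
      a b Comp_Id[OF ip(1)] by simp
  moreover have "b \<cdot> a = Id C K"
    using kernel_mono[OF kk Comp_Hom[OF a(1) b(1)] Id_Hom[OF O(2)]] Comp_assoc[OF a(1) b(1) kH]
      a b Comp_Id[OF kH] by simp
  ultimately have "is_iso C K X a" unfolding is_iso_def using a b by blast
  moreover have "Id C Y \<cdot> k = i \<cdot> a" "Id C Z \<cdot> p = p \<cdot> Id C Y"
    using Id_Comp[OF kH] a(2) Id_Comp[OF ip(2)] Comp_Id[OF ip(2)] by simp_all
  ultimately have "iso_pairs C (k, p) (i, p)"
    unfolding iso_pairs_def using kH ip is_iso_Id O by blast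
  then show ?thesis using conflation_iso[OF kE] by blast
qed

text \<open>
  A pair \<open>(u, v)\<close> to be factored through \<open>Y\<close> is lifted along \<open>p\<close> after passing to a deflation \<open>e\<close>
  onto its source; the lift, once corrected by \<open>i\<close>, kills the kernel of \<open>e\<close> and hence descends.
\<close>

lemma conflation_morphism_pullback:
  assumes E: "(i, p) \<in> E" and i: "i \<in> Hom C X Y" and p: "p \<in> Hom C Y Z"
    and k: "is_kernel C X J Q j q" and g: "g \<in> Hom C Y J" and w: "w \<in> Hom C Z Q"
    and gi: "g \<cdot> i = j" and qg: "q \<cdot> g = w \<cdot> p"
  shows "is_pullback C J Q Y Z q w p g"
proof -
  note kE = conflation_kernel_cokernel[OF E i p]
  have pi: "p \<cdot> i = Zero C X Z" using kE(1) unfolding is_kernel_def by blast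
  have j: "j \<in> Hom C X J" and q: "q \<in> Hom C J Q" using k unfolding is_kernel_def by auto
  have dp: "deflation E p" using E unfolding deflation_def by blast
  have O: "X \<in> Ob C" "Y \<in> Ob C" "Z \<in> Ob C" "J \<in> Ob C" "Q \<in> Ob C" using Hom_Ob i p g w by auto
  \<comment> \<open>\<open>p\<close> and \<open>g\<close> are jointly monic: what \<open>p\<close>
    kills factors through \<open>i\<close>, and \<open>g \<cdot> i = j\<close> is monic. This serves
    both the descent along \<open>e\<close> and uniqueness.\<close>
  have mono: "y = Zero C V Y"
    if y: "y \<in> Hom C V Y" "p \<cdot> y = Zero C V Z" "g \<cdot> y = Zero C V J" for V y
  proof -
    have V: "V \<in> Ob C" using y Hom_Ob by blast
    obtain h where h: "h \<in> Hom C V X" "i \<cdot> h = y" using kernel_factor[OF kE(1) y(1,2)] .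
    have "j \<cdot> h = j \<cdot> Zero C V X"
      using Comp_assoc[OF h(1) i g] gi h(2) y(3) Comp_Zero[OF j V] by simp
    then have "h = Zero C V X" using kernel_mono[OF k h(1) Zero_Hom[OF V O(1)]] by blast
    then show ?thesis using h(2) Comp_Zero[OF i V] by simp
  qed
  have "\<exists>!y. y \<in> Hom C W Y \<and> g \<cdot> y = u \<and> p \<cdot> y = v"
    if u: "u \<in> Hom C W J" and v: "v \<in> Hom C W Z" and uv: "q \<cdot> u = w \<cdot> v" for W u v
  proof -
    obtain W' e v1 where pb: "is_pullback C Y Z W' W p v e v1" and de: "deflation E e"
      using deflation_pullback[OF p dp v] by blast
    then have e: "e \<in> Hom C W' W" and v1: "v1 \<in> Hom C W' Y" and pv1: "p \<cdot> v1 = v \<cdot> e"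
      unfolding is_pullback_def by auto
    have W': "W' \<in> Ob C" using e Hom_Ob by blast
    obtain l where "(l, e) \<in> E" using de unfolding deflation_def by blast
    then obtain L where l: "l \<in> Hom C L W'" and ck: "is_cokernel C L W' W l e"
      using conflationE conflation_kernel_cokernel(2) e Hom_disjoint by metis
    have el: "e \<cdot> l = Zero C L W" using ck unfolding is_cokernel_def by blast
    have L: "L \<in> Ob C" using l Hom_Ob by blast
    note gv1 = Comp_Hom[OF v1 g] and ue = Comp_Hom[OF e u]
    \<comment> \<open>\<open>d\<close> is the defect of \<open>v1\<close> as a lift of
      \<open>u \<cdot> e\<close>. Both terms are sent by \<open>q\<close> to
      \<open>w \<cdot> v \<cdot> e\<close>, so \<open>d\<close> comes from \<open>X\<close> through
      \<open>j\<close>; correcting \<open>v1\<close> by the corresponding map through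
      \<open>i\<close> leaves its image under \<open>p\<close> unchanged.\<close>
    obtain d where d: "d \<in> Hom C W' J" "u \<cdot> e = (g \<cdot> v1) \<boxplus> d" using ex_difference[OF ue gv1] .
    have "(q \<cdot> (g \<cdot> v1)) \<boxplus> (q \<cdot> d) = q \<cdot> (u \<cdot> e)" using Comp_Add[OF gv1 d(1) q] d(2) by simp
    also have "\<dots> = w \<cdot> (v \<cdot> e)" using Comp_assoc[OF e u q] Comp_assoc[OF e v w] uv by simp
    also have "\<dots> = q \<cdot> (g \<cdot> v1)" using Comp_assoc[OF v1 p w] Comp_assoc[OF v1 g q] qg pv1 by simp
    finally have "(q \<cdot> (g \<cdot> v1)) \<boxplus> (q \<cdot> d) = (q \<cdot> (g \<cdot> v1)) \<boxplus> Zero C W' Q"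
      using Add_Zero[OF Comp_Hom[OF gv1 q]] by simp
    then have "q \<cdot> d = Zero C W' Q"
      using Add_left_cancel[OF Comp_Hom[OF gv1 q] Comp_Hom[OF d(1) q] Zero_Hom[OF W' O(5)]] by blast
    then obtain h where h: "h \<in> Hom C W' X" "j \<cdot> h = d" using kernel_factor[OF k d(1)] by blast
    note ih = Comp_Hom[OF h(1) i]
    define v2 where "v2 = v1 \<boxplus> (i \<cdot> h)"
    have v2: "v2 \<in> Hom C W' Y" unfolding v2_def using Add_Hom[OF v1 ih] .
    have pv2: "p \<cdot> v2 = v \<cdot> e"
      unfolding v2_def using Comp_Add[OF v1 ih p] Comp_assoc[OF h(1) i p] pi Zero_Comp[OF h(1) O(3)]
        pv1 Add_Zero[OF Comp_Hom[OF e v]] by simp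
    have gv2: "g \<cdot> v2 = u \<cdot> e"
      unfolding v2_def using Comp_Add[OF v1 ih g] Comp_assoc[OF h(1) i g] gi h(2) d(2) by simp
    have "p \<cdot> (v2 \<cdot> l) = Zero C L Z"
      using Comp_assoc[OF l v2 p] pv2 Comp_assoc[OF l e v] el Comp_Zero[OF v L] by simp
    moreover have "g \<cdot> (v2 \<cdot> l) = Zero C L J"
      using Comp_assoc[OF l v2 g] gv2 Comp_assoc[OF l e u] el Comp_Zero[OF u L] by simp
    ultimately have "v2 \<cdot> l = Zero C L Y" using mono Comp_Hom[OF l v2] by blast
    then obtain y where y: "y \<in> Hom C W Y" "y \<cdot> e = v2" using cokernel_factor[OF ck v2] by blast
    have "p \<cdot> y = v"
      using cokernel_epi[OF ck Comp_Hom[OF y(1) p] v] Comp_assoc[OF e y(1) p] y(2) pv2 by simp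
    moreover have "g \<cdot> y = u"
      using cokernel_epi[OF ck Comp_Hom[OF y(1) g] u] Comp_assoc[OF e y(1) g] y(2) gv2 by simp
    moreover have "z = y" if z: "z \<in> Hom C W Y" "g \<cdot> z = u" "p \<cdot> z = v" for z
    proof -
      obtain c where c: "c \<in> Hom C W Y" "z = y \<boxplus> c" using ex_difference[OF z(1) y(1)] .
      have W: "W \<in> Ob C" using u Hom_Ob by blast
      have "v \<boxplus> (p \<cdot> c) = v \<boxplus> Zero C W Z"
        using Comp_Add[OF y(1) c(1) p] c(2) z(3) \<open>p \<cdot> y = v\<close> Add_Zero[OF v] by simp
      then have "p \<cdot> c = Zero C W Z"
        using Add_left_cancel[OF v Comp_Hom[OF c(1) p] Zero_Hom[OF W O(3)]] by blast
      moreover have "u \<boxplus> (g \<cdot> c) = u \<boxplus> Zero C W J"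
        using Comp_Add[OF y(1) c(1) g] c(2) z(2) \<open>g \<cdot> y = u\<close> Add_Zero[OF u] by simp
      then have "g \<cdot> c = Zero C W J"
        using Add_left_cancel[OF u Comp_Hom[OF c(1) g] Zero_Hom[OF W O(4)]] by blast
      ultimately have "c = Zero C W Y" using mono c(1) by blast
      then show ?thesis using c(2) Add_Zero[OF y(1)] by simp
    qed
    ultimately show ?thesis using y(1) by blast
  qed
  then show ?thesis unfolding is_pullback_def using q w p g qg by blast
qed

end

section \<open>Frobenius categories\<close>

context preadditive_category
begin

lemma zero_object_Comp:
  assumes "zero_object C Z" "f \<in> Hom C X Z" "g \<in> Hom C Z Y"
  shows "g \<cdot> f = Zero C X Y"
proof -
  have "f = Zero C X Z"
    using Id_Comp[OF assms(2)] Zero_Comp[OF assms(2)] assms(1) zero_object_iff by metis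
  then show ?thesis using Comp_Zero[OF assms(3)] Hom_Ob[OF assms(2)] by simp
qed

text \<open>Allows the ends of a conflation to be replaced by isomorphic objects without touching
  its middle term.\<close>

lemma iso_pairs_transport_ends:
  assumes i: "i \<in> Hom C X Y" and p: "p \<in> Hom C Y Z"
    and x: "is_iso C X' X x" and z: "is_iso C Z Z' z"
  shows "iso_pairs C (i, p) (i \<cdot> x, z \<cdot> p)"
proof -
  obtain a where a: "is_iso C X X' a" "a \<in> Hom C X X'" "x \<cdot> a = Id C X"
    using is_iso_inverse[OF x] by metis
  have xz: "x \<in> Hom C X' X" "z \<in> Hom C Z Z'" using x z is_iso_def by metis+
  note zp = Comp_Hom[OF p xz(2)] and ix = Comp_Hom[OF xz(1) i]
  have "Id C Y \<cdot> i = (i \<cdot> x) \<cdot> a"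
    using Comp_assoc[OF a(2) xz(1) i] a(3) Comp_Id[OF i] Id_Comp[OF i] by simp
  moreover have "z \<cdot> p = (z \<cdot> p) \<cdot> Id C Y" using Comp_Id[OF zp] by simp
  moreover have "is_iso C Y Y (Id C Y)" using is_iso_Id Hom_Ob[OF p] by blast
  ultimately show ?thesis unfolding iso_pairs_def using i p ix zp a(1) z by blast
qed

end

text \<open>
  A conflation \<open>F X \<rightarrow> Y \<rightarrow> F Z\<close> is the pullback of the image of \<open>X \<rightarrow> J \<rightarrow> Q\<close>, \<open>J\<close> injective, along a
  morphism \<open>F Z \<rightarrow> F Q\<close>; since that morphism lifts to \<open>A\<close>, the pullback can be formed in \<open>A\<close>.
\<close>

lemma conflation_lift_fixed_ends:
  assumes "frobenius_category A EA" "frobenius_category B EB" and F: "exact_functor A EA B EB F"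
    and full: "full_functor A B F"
    and proj: "\<And>P. P \<in> projectives A EA \<Longrightarrow> fob F P \<in> projectives B EB"
    and X: "X \<in> Ob A" and Z: "Z \<in> Ob A" and E: "(i, p) \<in> EB"
    and i: "i \<in> Hom B (fob F X) Y" and p: "p \<in> Hom B Y (fob F Z)"
  obtains i' p' where "(i', p') \<in> EA" "iso_pairs B (fhom F i', fhom F p') (i, p)"
proof -
  interpret A: frobenius_category A EA by fact
  interpret B: frobenius_category B EB by fact
  have Ff: "is_functor A B F" and Fa: "additive_functor A B F"
    and FE: "\<And>i p. (i, p) \<in> EA \<Longrightarrow> (fhom F i, fhom F p) \<in> EB"
    using F unfolding exact_functor_def additive_functor_def by auto
  obtain J j where J: "J \<in> injectives A EA" "j \<in> Hom A X J" "inflation EA j"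
    using A.enough_injectives[OF X] by blast
  then obtain q where jq: "(j, q) \<in> EA" unfolding inflation_def by blast
  then obtain Q where q: "q \<in> Hom A J Q" using A.conflationE J(2) A.Hom_disjoint by metis
  note j = J(2)
  note Fj = functor_Hom[OF Ff j] and Fq = functor_Hom[OF Ff q]
  note kA = A.conflation_kernel_cokernel(1)[OF jq j q]
  note kF = B.conflation_kernel_cokernel(1)[OF FE[OF jq] Fj Fq]
  note cB = B.conflation_kernel_cokernel(2)[OF E i p]
  \<comment> \<open>The coincidence of projectives and injectives is used in both categories:
    \<open>F\<close> preserves projectives, whereas \<open>J\<close> is needed as an
    injective.\<close>
  have FJ: "fob F J \<in> injectives B EB"
    using J(1) proj A.projectives_eq_injectives B.projectives_eq_injectives by blast
  \<comment> \<open>Injectivity extends \<open>F j\<close> over \<open>Y\<close>. Then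
    \<open>F q \<cdot> g\<close> kills \<open>i\<close> and descends to the classifying map
    \<open>w'\<close> on \<open>F Z\<close>.\<close>
  obtain g where g: "g \<in> Hom B Y (fob F J)" "g \<cdot>\<^bsub>B\<^esub> i = fhom F j"
    using injectives_extend[OF FJ i _ Fj] E unfolding inflation_def by blast
  have "(fhom F q \<cdot>\<^bsub>B\<^esub> g) \<cdot>\<^bsub>B\<^esub> i = Zero B (fob F X) (fob F Q)"
    using B.Comp_assoc[OF i g(1) Fq] g(2) kF unfolding is_kernel_def by simp
  then obtain w' where w': "w' \<in> Hom B (fob F Z) (fob F Q)" "w' \<cdot>\<^bsub>B\<^esub> p = fhom F q \<cdot>\<^bsub>B\<^esub> g"
    using B.cokernel_factor[OF cB B.Comp_Hom[OF g(1) Fq]] by blast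
  have Q: "Q \<in> Ob A" using q A.Hom_Ob by blast
  obtain w where w: "w \<in> Hom A Z Q" "fhom F w = w'"
    using full w'(1) Z Q unfolding full_functor_def by blast
  have dq: "deflation EA q" using jq unfolding deflation_def by blast
  obtain Y' p' h where pb: "is_pullback A J Q Y' Z q w p' h" and dp': "deflation EA p'"
    using A.deflation_pullback[OF q dq w(1)] by blast
  obtain i' where k': "is_kernel A X Y' Z i' p'" and hi': "h \<cdot>\<^bsub>A\<^esub> i' = j"
    using A.pullback_kernel[OF pb kA] .
  have E': "(i', p') \<in> EA" using A.kernel_of_deflation[OF dp' k'] .
  have h: "h \<in> Hom A Y' J" "q \<cdot>\<^bsub>A\<^esub> h = w \<cdot>\<^bsub>A\<^esub> p'" using pb unfolding is_pullback_def by auto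
  have i': "i' \<in> Hom A X Y'" and p': "p' \<in> Hom A Y' Z" using k' unfolding is_kernel_def by auto
  note Fi' = functor_Hom[OF Ff i'] and Fp' = functor_Hom[OF Ff p'] and Fh = functor_Hom[OF Ff h(1)]
  have Fhi: "fhom F h \<cdot>\<^bsub>B\<^esub> fhom F i' = fhom F j" using functor_Comp[OF Ff i' h(1)] hi' by simp
  have "fhom F q \<cdot>\<^bsub>B\<^esub> fhom F h = w' \<cdot>\<^bsub>B\<^esub> fhom F p'"
    using functor_Comp[OF Ff h(1) q] functor_Comp[OF Ff p' w(1)] h(2) w(2) by simp
  \<comment> \<open>\<open>F\<close> is not known to preserve pullbacks. Both squares over
    \<open>w'\<close> are pullbacks because each belongs to a morphism of conflations that is the
    identity on \<open>F X\<close>.\<close>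
  then have pb1: "is_pullback B (fob F J) (fob F Q) (fob F Y') (fob F Z) (fhom F q) w' (fhom F p') (fhom F h)"
    using B.conflation_morphism_pullback[OF FE[OF E'] Fi' Fp' kF Fh w'(1) Fhi] by blast
  have pb2: "is_pullback B (fob F J) (fob F Q) Y (fob F Z) (fhom F q) w' p g"
    using B.conflation_morphism_pullback[OF E i p kF g(1) w'(1) g(2)] w'(2) by simp
  obtain b where b: "is_iso B (fob F Y') Y b" "p \<cdot>\<^bsub>B\<^esub> b = fhom F p'" "g \<cdot>\<^bsub>B\<^esub> b = fhom F h"
    using B.pullback_unique[OF pb1 pb2] .
  have bH: "b \<in> Hom B (fob F Y') Y" using b(1) is_iso_def by metis
  \<comment> \<open>Both composites vanish. This settles the \<open>p\<close>-component when
    \<open>b \<cdot> F i'\<close> is compared with \<open>i\<close> in the pullback; the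
    \<open>g\<close>-component is \<open>F j\<close> on both sides.\<close>
  have "fhom F p' \<cdot>\<^bsub>B\<^esub> fhom F i' = p \<cdot>\<^bsub>B\<^esub> i"
    using B.conflation_kernel_cokernel(1)[OF FE[OF E'] Fi' Fp'] cB
    unfolding is_kernel_def is_cokernel_def by simp
  then have "b \<cdot>\<^bsub>B\<^esub> fhom F i' = i"
    using B.pullback_eq[OF pb2 B.Comp_Hom[OF Fi' bH] i] B.Comp_assoc[OF Fi' bH g(1)]
      B.Comp_assoc[OF Fi' bH p] b Fhi g(2) by simp
  moreover have O: "fob F X \<in> Ob B" "fob F Z \<in> Ob B" using functor_Ob[OF Ff] X Z by blast+
  ultimately have "b \<cdot>\<^bsub>B\<^esub> fhom F i' = i \<cdot>\<^bsub>B\<^esub> Id B (fob F X)"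
    "Id B (fob F Z) \<cdot>\<^bsub>B\<^esub> fhom F p' = p \<cdot>\<^bsub>B\<^esub> b"
    using B.Comp_Id[OF i] B.Id_Comp[OF Fp'] b(2) by simp_all
  then have "iso_pairs B (fhom F i', fhom F p') (i, p)"
    unfolding iso_pairs_def using Fi' Fp' i p b(1) B.is_iso_Id O by blast
  then show ?thesis using that E' by blast
qed

text \<open>Density is applied to the two ends only; the middle term is constructed, and the change
  of ends is undone by composing isomorphisms of pairs.\<close>

lemma conflation_lift:
  assumes A: "frobenius_category A EA" and B: "frobenius_category B EB"
    and F: "exact_functor A EA B EB F" and full: "full_functor A B F" and dense: "dense_functor A B F"
    and proj: "\<And>P. P \<in> projectives A EA \<Longrightarrow> fob F P \<in> projectives B EB"
    and E: "(i, p) \<in> EB"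
  obtains i' p' where "(i', p') \<in> EA" "iso_pairs B (fhom F i', fhom F p') (i, p)"
proof -
  interpret B: frobenius_category B EB by fact
  obtain X Y Z where i: "i \<in> Hom B X Y" and p: "p \<in> Hom B Y Z" using B.conflationE[OF E] .
  obtain X' x where x: "X' \<in> Ob A" "is_iso B (fob F X') X x"
    using dense B.Hom_Ob[OF i] unfolding dense_functor_def isomorphic_def by blast
  obtain Z' z' where z': "Z' \<in> Ob A" "is_iso B (fob F Z') Z z'"
    using dense B.Hom_Ob[OF p] unfolding dense_functor_def isomorphic_def by blast
  then obtain z where z: "is_iso B Z (fob F Z') z" using B.is_iso_inverse by metis
  have xz: "x \<in> Hom B (fob F X') X" "z \<in> Hom B Z (fob F Z')" using x z is_iso_def by metis+
  have iso: "iso_pairs B (i, p) (i \<cdot>\<^bsub>B\<^esub> x, z \<cdot>\<^bsub>B\<^esub> p)"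
    using B.iso_pairs_transport_ends[OF i p x(2) z] .
  then have E': "(i \<cdot>\<^bsub>B\<^esub> x, z \<cdot>\<^bsub>B\<^esub> p) \<in> EB" using B.conflation_iso[OF E] by blast
  obtain i' p' where "(i', p') \<in> EA" "iso_pairs B (fhom F i', fhom F p') (i \<cdot>\<^bsub>B\<^esub> x, z \<cdot>\<^bsub>B\<^esub> p)"
    using conflation_lift_fixed_ends[OF A B F full proj x(1) z'(1) E'
        B.Comp_Hom[OF xz(1) i] B.Comp_Hom[OF p xz(2)]] .
  then show ?thesis using that B.iso_pairs_trans B.iso_pairs_sym[OF iso] by blast
qed

section \<open>The functor induced on stable categories\<close>

text \<open>Representatives differ by a morphism through a projective \<open>P\<close>, whose image
  factors through the projective \<open>F P\<close>; hence the union in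
  \<open>stable_functor\<close> runs over a constant family.\<close>

lemma stable_functor_class:
  assumes "frobenius_category A EA" "frobenius_category B EB" and F: "additive_functor A B F"
    and proj: "\<And>P. P \<in> projectives A EA \<Longrightarrow> fob F P \<in> projectives B EB"
    and f: "f \<in> Hom A X Y"
  shows "fhom (stable_functor B EB F) (factor_class A (projectives A EA) f) =
    factor_class B (projectives B EB) (fhom F f)"
proof -
  interpret A: frobenius_category A EA by fact
  interpret B: frobenius_category B EB by fact
  interpret SA: additive_subcategory A "projectives A EA"
    by unfold_locales (rule A.projectives_full_additive)
  interpret SB: additive_subcategory B "projectives B EB"
    by unfold_locales (rule B.projectives_full_additive)
  have Ff: "is_functor A B F" using F unfolding additive_functor_def by blast
  have "SB.cl (fhom F g) = SB.cl (fhom F f)" if g: "g \<in> SA.cl f" for g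
  proof -
    obtain d where d: "d \<in> SA.I X Y" "g = f \<boxplus>\<^bsub>A\<^esub> d" using SA.classE[OF g f] .
    obtain P u v where P: "P \<in> projectives A EA" "u \<in> Hom A X P" "v \<in> Hom A P Y" "d = v \<cdot>\<^bsub>A\<^esub> u"
      using SA.idealE[OF d(1)] .
    have "fhom F d \<in> SB.I (fob F X) (fob F Y)"
      using SB.idealI[OF proj[OF P(1)] functor_Hom[OF Ff P(2)] functor_Hom[OF Ff P(3)]]
        functor_Comp[OF Ff P(2,3)] P(4) by simp
    then show ?thesis
      using additive_functor_Add[OF F f SA.ideal_Hom[OF d(1)]] d(2)
        SB.class_Add_ideal[OF functor_Hom[OF Ff f]] by simp
  qed
  then have "(\<Union>g \<in> SA.cl f. SB.cl (fhom F g)) = (\<Union>g \<in> SA.cl f. SB.cl (fhom F f))" by simp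
  also have "\<dots> = SB.cl (fhom F f)" using SA.class_self[OF f] by blast
  finally show ?thesis unfolding stable_functor_def by simp
qed

text \<open>The condition on morphisms killed by \<open>F\<close> is stated for the ideal of
  projectives, which is what a removable subcategory supplies. Fullness and density are inherited
  from \<open>F\<close>; the work is in faithfulness.\<close>

lemma stable_functor_equivalence:
  assumes "frobenius_category A EA" "frobenius_category B EB" and F: "exact_functor A EA B EB F"
    and full: "full_functor A B F" and dense: "dense_functor A B F"
    and proj: "\<And>P. P \<in> projectives A EA \<Longrightarrow> fob F P \<in> projectives B EB"
    and ker: "\<And>X Y f. f \<in> Hom A X Y \<Longrightarrow> fhom F f = Zero B (fob F X) (fob F Y) \<Longrightarrow>
      f \<in> factor_ideal A (projectives A EA) X Y"
  shows "equivalence (stable_category A EA) (stable_category B EB) (stable_functor B EB F)"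
proof -
  interpret A: frobenius_category A EA by fact
  interpret B: frobenius_category B EB by fact
  interpret SA: additive_subcategory A "projectives A EA"
    by unfold_locales (rule A.projectives_full_additive)
  interpret SB: additive_subcategory B "projectives B EB"
    by unfold_locales (rule B.projectives_full_additive)
  have Fa: "additive_functor A B F" and Ff: "is_functor A B F"
    and FE: "\<And>i p. (i, p) \<in> EA \<Longrightarrow> (fhom F i, fhom F p) \<in> EB"
    using F unfolding exact_functor_def additive_functor_def by auto
  let ?H = "stable_functor B EB F" and ?K = "comp_functor (factor_functor B (projectives B EB)) F"
  have Ka: "additive_functor A SB.D ?K" using comp_additive_functor[OF Fa SB.factor_functor_additive] .
  have Kf: "full_functor A SB.D ?K" using comp_full_functor[OF Ff full SB.factor_functor_full] .
  have pf: "is_functor B SB.D (factor_functor B (projectives B EB))"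
    using SB.factor_functor_additive unfolding additive_functor_def by blast
  have Kd: "dense_functor A SB.D ?K"
    using comp_dense_functor[OF B.preadditive_category_axioms SB.preadditive_factor pf dense
        SB.factor_functor_dense] .
  have ob: "fob ?H X = fob ?K X" for X unfolding stable_functor_def by simp
  have hom: "fhom ?H (SA.cl f) = fhom ?K f" if "f \<in> Hom A X Y" for X Y f
    using stable_functor_class[OF assms(1,2) Fa proj that] by simp
  have Ha: "additive_functor SA.D SB.D ?H" using SA.factor_additive_functorI[OF Ka ob hom] .
  have Hfull: "full_functor SA.D SB.D ?H" using SA.factor_full_functorI[OF Kf ob hom] .
  note Hdense = SA.factor_dense_functorI[OF Kd ob]
  have "T = Zero SA.D X Y" if T: "T \<in> Hom SA.D X Y" and T0: "fhom ?H T = Zero SB.D (fob ?H X) (fob ?H Y)" for X Y T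
  proof -
    obtain f where f: "f \<in> Hom A X Y" "T = SA.cl f" using T unfolding SA.factor_simps by blast
    note Ffm = functor_Hom[OF Ff f(1)]
    have O: "X \<in> Ob A" "Y \<in> Ob A" using A.Hom_Ob[OF f(1)] by auto
    have "SB.cl (fhom F f) = SB.cl (Zero B (fob F X) (fob F Y))"
      using T0 f(2) hom[OF f(1)] ob unfolding SB.factor_simps by simp
    then have "fhom F f \<in> SB.I (fob F X) (fob F Y)" using SB.class_eq_Zero_iff[OF Ffm] by blast
    then obtain P' u v where P': "P' \<in> projectives B EB" "u \<in> Hom B (fob F X) P'" "v \<in> Hom B P' (fob F Y)"
      "fhom F f = v \<cdot>\<^bsub>B\<^esub> u" by (rule SB.idealE)
    \<comment> \<open>\<open>P'\<close> need not come from \<open>A\<close>. Lifting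
      \<open>v\<close> along the deflation \<open>F q\<close> trades it for \<open>F P\<close>,
      after which the map from \<open>F X\<close> to \<open>F P\<close> can be lifted by
      fullness.\<close>
    obtain P q where P: "P \<in> projectives A EA" "q \<in> Hom A P Y" "deflation EA q"
      using A.enough_projectives[OF O(2)] by blast
    have PO: "P \<in> Ob A" using A.Hom_Ob[OF P(2)] by blast
    have "deflation EB (fhom F q)" using P(3) FE unfolding deflation_def by blast
    then obtain w where w: "w \<in> Hom B P' (fob F P)" "fhom F q \<cdot>\<^bsub>B\<^esub> w = v"
      using projectives_lift[OF P'(1) functor_Hom[OF Ff P(2)] _ P'(3)] by blast
    obtain k where k: "k \<in> Hom A X P" "fhom F k = w \<cdot>\<^bsub>B\<^esub> u"
      using full O(1) PO B.Comp_Hom[OF P'(2) w(1)] unfolding full_functor_def by blast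
    note qk = A.Comp_Hom[OF k(1) P(2)]
    obtain d where d: "d \<in> Hom A X Y" "f = (q \<cdot>\<^bsub>A\<^esub> k) \<boxplus>\<^bsub>A\<^esub> d" using A.ex_difference[OF f(1) qk] .
    have "fhom F (q \<cdot>\<^bsub>A\<^esub> k) = fhom F f"
      using functor_Comp[OF Ff k(1) P(2)] k(2) B.Comp_assoc[OF P'(2) w(1) functor_Hom[OF Ff P(2)]]
        w(2) P'(4) by simp
    then have "fhom F f \<boxplus>\<^bsub>B\<^esub> fhom F d = fhom F f \<boxplus>\<^bsub>B\<^esub> Zero B (fob F X) (fob F Y)"
      using additive_functor_Add[OF Fa qk d(1)] d(2) B.Add_Zero[OF Ffm] by simp
    then have "fhom F d = Zero B (fob F X) (fob F Y)"
      using B.Add_left_cancel[OF Ffm functor_Hom[OF Ff d(1)]] B.Zero_Hom B.Hom_Ob[OF Ffm] by blast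
    then have "d \<in> SA.I X Y" using ker d(1) by blast
    then have "f \<in> SA.I X Y" using SA.ideal_Add SA.idealI[OF P(1) k(1) P(2)] d(2) by blast
    then show ?thesis using SA.class_eq_Zero_iff[OF f(1)] f(2) unfolding SA.factor_simps by simp
  qed
  then have "faithful_functor SA.D SB.D ?H"
    using additive_faithfulI[OF SA.preadditive_factor SB.preadditive_factor Ha] by blast
  then obtain G where "quasi_inverse SA.D SB.D ?H G"
    using fully_faithful_dense_quasi_inverse[OF SA.preadditive_factor SB.preadditive_factor _ Hfull _ Hdense]
      Ha unfolding additive_functor_def by blast
  then show ?thesis unfolding equivalence_def stable_category_def by blast
qed

section \<open>Properties of a Frobenius quotient\<close>

text \<open>\<open>G\<close> moves a lifting problem for a deflation \<open>p\<close> of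
  \<open>B\<close> to the factor category, where \<open>G p\<close> is isomorphic to the class of a
  deflation \<open>p0\<close> of \<open>A\<close>. A representative is lifted along
  \<open>p0\<close> by projectivity of \<open>P\<close>, and the solution returns to
  \<open>B\<close> because \<open>G\<close> is full and faithful.\<close>

lemma exact_quasi_inverse_projectives:
  assumes "frobenius_category A EA" "frobenius_category B EB" and S: "full_additive_subcategory A S"
    and qi: "quasi_inverse (factor_category A S) B F' G"
    and G: "exact_functor B EB (factor_category A S) (factor_conflations A EA S) G"
    and P: "P \<in> projectives A EA"
  shows "fob F' P \<in> projectives B EB"
proof -
  interpret A: frobenius_category A EA by fact
  interpret B: frobenius_category B EB by fact
  interpret S: additive_subcategory A S by unfold_locales (rule S)
  interpret D: preadditive_category S.D by (rule S.preadditive_factor)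
  have F'f: "is_functor S.D B F'" and Gf: "is_functor B S.D G"
    and GE: "\<And>i p. (i, p) \<in> EB \<Longrightarrow> (fhom G i, fhom G p) \<in> factor_conflations A EA S"
    using qi G unfolding exact_functor_def quasi_inverse_def by auto
  note G_full = quasi_inverse_full[OF B.preadditive_category_axioms S.preadditive_factor quasi_inverse_sym[OF qi]]
  note G_faith = quasi_inverse_faithful[OF B.preadditive_category_axioms quasi_inverse_sym[OF qi]]
  have PO: "P \<in> Ob A" using P unfolding projectives_def by blast
  then have PD: "P \<in> Ob S.D" unfolding S.factor_simps .
  note F'P = functor_Ob[OF F'f PD]
  obtain e t where e: "e \<in> Hom S.D (fob G (fob F' P)) P" and t: "t \<in> Hom S.D P (fob G (fob F' P))"
    "t \<cdot>\<^bsub>S.D\<^esub> e = Id S.D (fob G (fob F' P))"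
    using qi naturally_isomorphic_comp_id[of S.D G F'] PD unfolding quasi_inverse_def is_iso_def by metis
  have "\<exists>n \<in> Hom B (fob F' P) Y. p \<cdot>\<^bsub>B\<^esub> n = f"
    if p: "p \<in> Hom B Y Z" "deflation EB p" and f: "f \<in> Hom B (fob F' P) Z" for Y Z p f
  proof -
    obtain k where "(k, p) \<in> EB" using p(2) unfolding deflation_def by blast
    then obtain i0 p0 where E0: "(i0, p0) \<in> EA" and iso: "iso_pairs S.D (S.cl i0, S.cl p0) (fhom G k, fhom G p)"
      using GE unfolding factor_conflations_def by fastforce
    obtain X0 Y0 Z0 where p0: "p0 \<in> Hom A Y0 Z0" using A.conflationE[OF E0] by blast
    have cp0: "S.cl p0 \<in> Hom S.D Y0 Z0" using p0 unfolding S.factor_simps by blast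
    note Gp = functor_Hom[OF Gf p(1)] and Gfm = functor_Hom[OF Gf f]
    obtain b c where b: "b \<in> Hom S.D Y0 (fob G Y)" and c: "is_iso S.D Z0 (fob G Z) c"
      and cb: "c \<cdot>\<^bsub>S.D\<^esub> S.cl p0 = fhom G p \<cdot>\<^bsub>S.D\<^esub> b"
    proof -
      obtain Y1 Z1 Y2 Z2 b c where 1: "S.cl p0 \<in> Hom S.D Y1 Z1" "fhom G p \<in> Hom S.D Y2 Z2"
        and 2: "is_iso S.D Y1 Y2 b" "is_iso S.D Z1 Z2 c" "c \<cdot>\<^bsub>S.D\<^esub> S.cl p0 = fhom G p \<cdot>\<^bsub>S.D\<^esub> b"
        using iso unfolding iso_pairs_def by blast
      have eq: "Y1 = Y0" "Z1 = Z0" "Y2 = fob G Y" "Z2 = fob G Z"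
        using D.Hom_disjoint[OF 1(1) cp0] D.Hom_disjoint[OF 1(2) Gp] by auto
      show ?thesis
        using that[OF _ 2(2)[unfolded eq] 2(3)] 2(1)[unfolded eq is_iso_def] by blast
    qed
    then obtain c' where c': "c' \<in> Hom S.D (fob G Z) Z0" "c \<cdot>\<^bsub>S.D\<^esub> c' = Id S.D (fob G Z)"
      and cH: "c \<in> Hom S.D Z0 (fob G Z)"
      unfolding is_iso_def by blast
    note Gft = D.Comp_Hom[OF t(1) Gfm]
    \<comment> \<open>The problem becomes a morphism from \<open>P\<close> to \<open>Z0\<close> in
      \<open>A\<close>: enter through \<open>t\<close>, apply \<open>G f\<close>, return along the
      inverse of \<open>c\<close>, and choose a representative.\<close>
    obtain h where h: "h \<in> Hom A P Z0" "S.cl h = c' \<cdot>\<^bsub>S.D\<^esub> (fhom G f \<cdot>\<^bsub>S.D\<^esub> t)"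
      using D.Comp_Hom[OF Gft c'(1)] unfolding S.factor_simps by (metis imageE)
    have dp0: "deflation EA p0" using E0 unfolding deflation_def by blast
    obtain m where m: "m \<in> Hom A P Y0" "p0 \<cdot>\<^bsub>A\<^esub> m = h" using projectives_lift[OF P p0 dp0 h(1)] by blast
    have cm: "S.cl m \<in> Hom S.D P Y0" using m(1) unfolding S.factor_simps by blast
    note bm = D.Comp_Hom[OF cm b]
    note bme = D.Comp_Hom[OF e bm]
    obtain n where n: "n \<in> Hom B (fob F' P) Y" "fhom G n = (b \<cdot>\<^bsub>S.D\<^esub> S.cl m) \<cdot>\<^bsub>S.D\<^esub> e"
      using G_full F'P B.Hom_Ob[OF p(1)] bme unfolding full_functor_def by blast
    have "fhom G p \<cdot>\<^bsub>S.D\<^esub> (b \<cdot>\<^bsub>S.D\<^esub> S.cl m) = c \<cdot>\<^bsub>S.D\<^esub> S.cl h"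
      using D.Comp_assoc[OF cm b Gp] cb D.Comp_assoc[OF cm cp0 cH] S.Comp_class[OF m(1) p0] m(2) by simp
    also have "\<dots> = fhom G f \<cdot>\<^bsub>S.D\<^esub> t"
      using h(2) D.Comp_assoc[OF Gft c'(1) cH] c'(2) D.Id_Comp[OF Gft] by simp
    finally have "fhom G (p \<cdot>\<^bsub>B\<^esub> n) = (fhom G f \<cdot>\<^bsub>S.D\<^esub> t) \<cdot>\<^bsub>S.D\<^esub> e"
      using functor_Comp[OF Gf n(1) p(1)] n(2) D.Comp_assoc[OF e bm Gp] by simp
    also have "\<dots> = fhom G f" using D.Comp_assoc[OF e t(1) Gfm] t(2) D.Comp_Id[OF Gfm] by simp
    finally have "p \<cdot>\<^bsub>B\<^esub> n = f" using faithfulD[OF G_faith B.Comp_Hom[OF n(1) p(1)] f] by blast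
    then show ?thesis using n(1) by blast
  qed
  then show ?thesis unfolding projectives_def using F'P by blast
qed

lemma frobenius_quotientD:
  assumes "frobenius_category A EA" "frobenius_category B EB" "frobenius_quotient A EA B EB F"
  shows "pretriangle_equivalence A EA B EB F" "objective A B F" "full_functor A B F" "dense_functor A B F"
proof -
  interpret A: frobenius_category A EA by fact
  interpret B: frobenius_category B EB by fact
  have Fa: "additive_functor A B F" using assms(3) unfolding frobenius_quotient_def by blast
  then have Ff: "is_functor A B F" unfolding additive_functor_def by blast
  obtain S F' G where rem: "removable A EA S"
    and F'E: "exact_functor (factor_category A S) (factor_conflations A EA S) B EB F'"
    and GE: "exact_functor B EB (factor_category A S) (factor_conflations A EA S) G"
    and qi: "quasi_inverse (factor_category A S) B F' G"
    and eq: "functor_eq A F (comp_functor F' (factor_functor A S))"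
    using assms(3) unfolding frobenius_quotient_def exact_equivalence_def by blast
  have S: "full_additive_subcategory A S" "S \<subseteq> projectives A EA" using rem unfolding removable_def by auto
  interpret S: additive_subcategory A S by unfold_locales (rule S(1))
  interpret D: preadditive_category S.D by (rule S.preadditive_factor)
  have ob: "fob F X = fob F' X" if "X \<in> Ob A" for X using eq that unfolding functor_eq_def by simp
  have hom: "fhom F f = fhom F' (S.cl f)" if "f \<in> Hom A X Y" for f X Y
    using eq that unfolding functor_eq_def by simp
  have F'a: "additive_functor S.D B F'" using F'E unfolding exact_functor_def by blast
  note F'full = quasi_inverse_full[OF S.preadditive_factor B.preadditive_category_axioms qi]
  note F'faith = quasi_inverse_faithful[OF S.preadditive_factor qi]
  show full: "full_functor A B F"
    unfolding full_functor_def
  proof (intro ballI)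
    fix X Y g assume X: "X \<in> Ob A" "Y \<in> Ob A" and "g \<in> Hom B (fob F X) (fob F Y)"
    then have "g \<in> Hom B (fob F' X) (fob F' Y)" using ob by simp
    then have "\<exists>T \<in> Hom S.D X Y. fhom F' T = g"
      using F'full X unfolding full_functor_def S.factor_simps(1) by blast
    then obtain f where "f \<in> Hom A X Y" "fhom F' (S.cl f) = g" unfolding S.factor_simps by blast
    then show "\<exists>f\<in>Hom A X Y. fhom F f = g" using hom by metis
  qed
  show dense: "dense_functor A B F"
    using quasi_inverse_dense[OF qi] ob unfolding dense_functor_def S.factor_simps by metis
  have exact: "exact_functor A EA B EB F"
    unfolding exact_functor_def
  proof (intro conjI Fa ballI, clarify)
    fix i p assume E: "(i, p) \<in> EA"
    obtain X Y Z where i: "i \<in> Hom A X Y" and p: "p \<in> Hom A Y Z" using A.conflationE[OF E] .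
    have "S.cl i \<in> Hom S.D X Y" "S.cl p \<in> Hom S.D Y Z" using i p unfolding S.factor_simps by blast+
    then have "iso_pairs S.D (S.cl i, S.cl p) (S.cl i, S.cl p)" by (rule D.iso_pairs_refl)
    then have "(S.cl i, S.cl p) \<in> factor_conflations A EA S"
      unfolding factor_conflations_def using E by auto
    then show "(fhom F i, fhom F p) \<in> EB"
      using F'E hom[OF i] hom[OF p] unfolding exact_functor_def by auto
  qed
  have proj: "fob F P \<in> projectives B EB" if P: "P \<in> projectives A EA" for P
    using exact_quasi_inverse_projectives[OF assms(1,2) S(1) qi GE P] ob P
    unfolding projectives_def by simp
  have Zero: "fhom F' (Zero S.D X Y) = Zero B (fob F X) (fob F Y)" if "X \<in> Ob A" "Y \<in> Ob A" for X Y
    using additive_functor_Zero[OF S.preadditive_factor B.preadditive_category_axioms F'a] that ob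
    by (simp add: S.factor_simps(1))
  \<comment> \<open>By faithfulness of \<open>F'\<close>, what \<open>F\<close> kills vanishes in
    the factor category and so factors through \<open>S\<close>. This yields objectivity and,
    \<open>S\<close> consisting of projectives, the kernel condition for the stable
    equivalence.\<close>
  have ker: "f \<in> S.I X Y" if f: "f \<in> Hom A X Y" and f0: "fhom F f = Zero B (fob F X) (fob F Y)" for X Y f
  proof -
    have O: "X \<in> Ob A" "Y \<in> Ob A" using A.Hom_Ob[OF f] by auto
    have "S.cl f \<in> Hom S.D X Y" using f unfolding S.factor_simps by blast
    moreover have "Zero S.D X Y \<in> Hom S.D X Y" using D.Zero_Hom O unfolding S.factor_simps(1) by blast
    moreover have "fhom F' (S.cl f) = fhom F' (Zero S.D X Y)" using Zero[OF O] hom[OF f] f0 by simp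
    ultimately have "S.cl f = Zero S.D X Y" using faithfulD[OF F'faith] by blast
    then show ?thesis using S.class_eq_Zero_iff[OF f] unfolding S.factor_simps by blast
  qed
  have "S \<subseteq> essential_kernel A B F"
  proof
    fix X assume X: "X \<in> S"
    then have O: "X \<in> Ob A" using S(1) unfolding full_additive_subcategory_def by blast
    note I = A.Id_Hom[OF O]
    have "Id A X \<in> S.I X X" using S.idealI[OF X I I] A.Comp_Id[OF I] by simp
    then have "S.cl (Id A X) = Zero S.D X X" using S.class_eq_Zero_iff[OF I] unfolding S.factor_simps by simp
    then have "Id B (fob F X) = Zero B (fob F X) (fob F X)"
      using functor_Id[OF Ff O] hom[OF I] Zero[OF O O] by simp
    then show "X \<in> essential_kernel A B F"
      unfolding essential_kernel_def using O B.zero_object_iff functor_Ob[OF Ff O] by blast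
  qed
  then show "objective A B F"
    using ker unfolding objective_def factor_ideal_def by blast
  have "f \<in> factor_ideal A (projectives A EA) X Y"
    if "f \<in> Hom A X Y" "fhom F f = Zero B (fob F X) (fob F Y)" for X Y f
    using ker[OF that] S(2) unfolding factor_ideal_def by blast
  then show "pretriangle_equivalence A EA B EB F"
    unfolding pretriangle_equivalence_def
    using exact proj stable_functor_equivalence[OF assms(1,2) exact full dense proj] by blast
qed

section \<open>The essential kernel and the quotient by its ideal\<close>

text \<open>Membership is tested by whether \<open>F\<close> kills the identity; on a biproduct the
  identity is a sum of morphisms through objects that \<open>F\<close> annihilates.\<close>

lemma essential_kernel_full_additive:
  assumes "additive_category A" "preadditive_category B" and F: "additive_functor A B F"
  shows "full_additive_subcategory A (essential_kernel A B F)"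
proof -
  interpret A: additive_category A by fact
  interpret B: preadditive_category B by fact
  have Ff: "is_functor A B F" using F unfolding additive_functor_def by blast
  note Zero = additive_functor_Zero[OF A.preadditive_category_axioms assms(2) F]
  have kerI: "X \<in> essential_kernel A B F" if "X \<in> Ob A" "fhom F (Id A X) = Zero B (fob F X) (fob F X)" for X
    unfolding essential_kernel_def B.zero_object_iff
    using that functor_Ob[OF Ff] functor_Id[OF Ff] by simp
  obtain Z where Z: "zero_object A Z" using A.ex_zero_object by blast
  then have ZO: "Z \<in> Ob A" "Id A Z = Zero A Z Z" using A.zero_object_iff by auto
  then have "Z \<in> essential_kernel A B F" using kerI Zero by simp
  moreover have "\<exists>W \<in> essential_kernel A B F. biproduct A X Y W"
    if X: "X \<in> essential_kernel A B F" and Y: "Y \<in> essential_kernel A B F" for X Y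
  proof -
    have X0: "X \<in> Ob A" "zero_object B (fob F X)" "Y \<in> Ob A" "zero_object B (fob F Y)"
      using X Y unfolding essential_kernel_def by auto
    obtain W where W: "biproduct A X Y W" using A.ex_biproduct X0 by blast
    then obtain i j p q where b: "i \<in> Hom A X W" "j \<in> Hom A Y W" "p \<in> Hom A W X" "q \<in> Hom A W Y"
      "(i \<cdot>\<^bsub>A\<^esub> p) \<boxplus>\<^bsub>A\<^esub> (j \<cdot>\<^bsub>A\<^esub> q) = Id A W"
      unfolding biproduct_def by blast
    have WO: "W \<in> Ob A" using A.Hom_Ob[OF b(1)] by blast
    note FW = functor_Ob[OF Ff WO]
    have "fhom F (Id A W) = fhom F (i \<cdot>\<^bsub>A\<^esub> p) \<boxplus>\<^bsub>B\<^esub> fhom F (j \<cdot>\<^bsub>A\<^esub> q)"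
      using additive_functor_Add[OF F A.Comp_Hom[OF b(3,1)] A.Comp_Hom[OF b(4,2)]] b(5) by simp
    also have "\<dots> = Zero B (fob F W) (fob F W) \<boxplus>\<^bsub>B\<^esub> Zero B (fob F W) (fob F W)"
      using functor_Comp[OF Ff b(3,1)] functor_Comp[OF Ff b(4,2)]
        B.zero_object_Comp[OF X0(2) functor_Hom[OF Ff b(3)] functor_Hom[OF Ff b(1)]]
        B.zero_object_Comp[OF X0(4) functor_Hom[OF Ff b(4)] functor_Hom[OF Ff b(2)]] by simp
    also have "\<dots> = Zero B (fob F W) (fob F W)" using B.Add_Zero[OF B.Zero_Hom[OF FW FW]] .
    finally show ?thesis using kerI WO W by blast
  qed
  ultimately show ?thesis
    unfolding full_additive_subcategory_def using Z unfolding essential_kernel_def by blast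
qed

text \<open>Faithfulness of the stable functor turns vanishing after \<open>F\<close> into the
  statement that the identity of \<open>X\<close> lies in the ideal of projectives. A factorization
  of it makes \<open>X\<close> a retract of a projective.\<close>

lemma essential_kernel_projective:
  assumes "frobenius_category A EA" "frobenius_category B EB" "pretriangle_equivalence A EA B EB F"
  shows "essential_kernel A B F \<subseteq> projectives A EA"
proof
  fix X assume X: "X \<in> essential_kernel A B F"
  interpret A: frobenius_category A EA by fact
  interpret B: frobenius_category B EB by fact
  interpret SA: additive_subcategory A "projectives A EA"
    by unfold_locales (rule A.projectives_full_additive)
  have Fa: "additive_functor A B F" and Ff: "is_functor A B F"
    and proj: "\<And>P. P \<in> projectives A EA \<Longrightarrow> fob F P \<in> projectives B EB"
    using assms(3) unfolding pretriangle_equivalence_def exact_functor_def additive_functor_def by auto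
  have XO: "X \<in> Ob A" and "zero_object B (fob F X)" using X unfolding essential_kernel_def by auto
  then have F0: "Id B (fob F X) = Zero B (fob F X) (fob F X)" using B.zero_object_iff by blast
  note I = A.Id_Hom[OF XO] and Z = A.Zero_Hom[OF XO XO]
  have "fhom F (Id A X) = fhom F (Zero A X X)"
    using functor_Id[OF Ff XO] F0
      additive_functor_Zero[OF A.preadditive_category_axioms B.preadditive_category_axioms Fa XO XO] by simp
  then have "fhom (stable_functor B EB F) (SA.cl (Id A X)) = fhom (stable_functor B EB F) (SA.cl (Zero A X X))"
    using stable_functor_class[OF assms(1,2) Fa proj I] stable_functor_class[OF assms(1,2) Fa proj Z] by simp
  moreover have "faithful_functor SA.D (stable_category B EB) (stable_functor B EB F)"
    using assms(3) quasi_inverse_faithful[OF SA.preadditive_factor]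
    unfolding pretriangle_equivalence_def equivalence_def stable_category_def by blast
  ultimately have "SA.cl (Id A X) = SA.cl (Zero A X X)"
    using faithfulD[of SA.D "stable_category B EB" "stable_functor B EB F" "SA.cl (Id A X)" X X "SA.cl (Zero A X X)"]
      I Z unfolding SA.factor_simps by blast
  then have "Id A X \<in> SA.I X X" using SA.class_eq_Zero_iff[OF I] by blast
  then obtain P u v where "P \<in> projectives A EA" "u \<in> Hom A X P" "v \<in> Hom A P X" "Id A X = v \<cdot>\<^bsub>A\<^esub> u"
    by (rule SA.idealE)
  then show "X \<in> projectives A EA" using A.retract_projective by metis
qed

lemma quasi_inverse_iso_pairs:
  assumes "preadditive_category A" and qi: "quasi_inverse A B F G"
    and i: "i \<in> Hom A X Y" and p: "p \<in> Hom A Y Z"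
  shows "iso_pairs A (fhom G (fhom F i), fhom G (fhom F p)) (i, p)"
proof -
  have F: "is_functor A B F" "is_functor B A G" using qi unfolding quasi_inverse_def by auto
  obtain e where e: "\<And>X. X \<in> Ob A \<Longrightarrow> is_iso A (fob G (fob F X)) X (e X)"
    "\<And>f X Y. f \<in> Hom A X Y \<Longrightarrow> e Y \<cdot>\<^bsub>A\<^esub> fhom G (fhom F f) = f \<cdot>\<^bsub>A\<^esub> e X"
    using qi naturally_isomorphic_comp_id unfolding quasi_inverse_def by blast
  have "X \<in> Ob A" "Y \<in> Ob A" "Z \<in> Ob A"
    using preadditive_category.Hom_Ob[OF assms(1)] i p by blast+
  then show ?thesis
    unfolding iso_pairs_def
    using e(1) e(2)[OF i] e(2)[OF p] i p functor_Hom[OF F(2) functor_Hom[OF F(1)]] by blast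
qed

lemma frobenius_quotientI:
  assumes "frobenius_category A EA" "frobenius_category B EB" and pt: "pretriangle_equivalence A EA B EB F"
    and obj: "objective A B F" and full: "full_functor A B F" and dense: "dense_functor A B F"
  shows "frobenius_quotient A EA B EB F"
proof -
  interpret A: frobenius_category A EA by fact
  interpret B: frobenius_category B EB by fact
  have exact: "exact_functor A EA B EB F" and Fa: "additive_functor A B F" and Ff: "is_functor A B F"
    and FE: "\<And>i p. (i, p) \<in> EA \<Longrightarrow> (fhom F i, fhom F p) \<in> EB"
    and proj: "\<And>P. P \<in> projectives A EA \<Longrightarrow> fob F P \<in> projectives B EB"
    using pt unfolding pretriangle_equivalence_def exact_functor_def additive_functor_def by auto
  define S where "S = essential_kernel A B F"
  have S_add: "full_additive_subcategory A S"
    unfolding S_def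
    by (rule essential_kernel_full_additive[OF A.additive_category_axioms B.preadditive_category_axioms Fa])
  interpret S: additive_subcategory A S by unfold_locales (rule S_add)
  interpret D: preadditive_category S.D by (rule S.preadditive_factor)
  \<comment> \<open>A function on cosets must pick a representative. The choice is harmless:
    representatives differ by a morphism through an object of \<open>S\<close>, and \<open>F\<close>
    sends that morphism to zero.\<close>
  define F' :: "('a, 'b set, 'c, 'd) func" where "F' = \<lparr>fob = fob F, fhom = (\<lambda>T. fhom F (SOME f. f \<in> T))\<rparr>"
  have ob: "fob F' X = fob F X" for X unfolding F'_def by simp
  have hom: "fhom F' (S.cl f) = fhom F f" if f: "f \<in> Hom A X Y" for f X Y
  proof -
    have "(SOME g. g \<in> S.cl f) \<in> S.cl f" using S.class_self[OF f] by (rule someI)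
    then obtain d where d: "d \<in> S.I X Y" "(SOME g. g \<in> S.cl f) = f \<boxplus>\<^bsub>A\<^esub> d" using S.classE f by metis
    obtain P u v where P: "P \<in> S" "u \<in> Hom A X P" "v \<in> Hom A P Y" "d = v \<cdot>\<^bsub>A\<^esub> u"
      using S.idealE[OF d(1)] .
    have "zero_object B (fob F P)" using P(1) unfolding S_def essential_kernel_def by blast
    then have "fhom F d = Zero B (fob F X) (fob F Y)"
      using B.zero_object_Comp functor_Hom[OF Ff P(2)] functor_Hom[OF Ff P(3)]
        functor_Comp[OF Ff P(2,3)] P(4) by metis
    then show ?thesis
      unfolding F'_def
      using d(2) additive_functor_Add[OF Fa f S.ideal_Hom[OF d(1)]] B.Add_Zero[OF functor_Hom[OF Ff f]] by simp
  qed
  have F'a: "additive_functor S.D B F'" using S.factor_additive_functorI[OF Fa ob hom] .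
  then have F'f: "is_functor S.D B F'" unfolding additive_functor_def by blast
  have F'full: "full_functor S.D B F'" using S.factor_full_functorI[OF full ob hom] .
  have F'dense: "dense_functor S.D B F'" using S.factor_dense_functorI[OF dense ob] .
  \<comment> \<open>Objectivity is exactly triviality of the kernel of \<open>F'\<close>.\<close>
  have "T = Zero S.D X Y" if T: "T \<in> Hom S.D X Y" and T0: "fhom F' T = Zero B (fob F' X) (fob F' Y)" for X Y T
  proof -
    obtain f where f: "f \<in> Hom A X Y" "T = S.cl f" using T unfolding S.factor_simps by blast
    have "fhom F f = Zero B (fob F X) (fob F Y)" using T0 f(2) hom[OF f(1)] ob by simp
    then have "f \<in> S.I X Y" using obj f(1) unfolding objective_def S_def by blast
    then show ?thesis using S.class_eq_Zero_iff[OF f(1)] f(2) unfolding S.factor_simps by simp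
  qed
  then have F'faith: "faithful_functor S.D B F'"
    using additive_faithfulI[OF S.preadditive_factor B.preadditive_category_axioms F'a] by blast
  obtain G where qi: "quasi_inverse S.D B F' G"
    using fully_faithful_dense_quasi_inverse[OF S.preadditive_factor B.preadditive_category_axioms
        F'f F'full F'faith F'dense] .
  have cl_Hom: "S.cl f \<in> Hom S.D X Y" if "f \<in> Hom A X Y" for f X Y
    using that unfolding S.factor_simps by blast
  have "kernel_cokernel_pair S.D (S.cl i, S.cl p)" if E: "(i, p) \<in> EA" for i p
  proof -
    obtain X Y Z where i: "i \<in> Hom A X Y" and p: "p \<in> Hom A Y Z" using A.conflationE[OF E] .
    note kc = B.conflation_kernel_cokernel[OF FE[OF E] functor_Hom[OF Ff i] functor_Hom[OF Ff p]]
    note r = S.preadditive_factor B.preadditive_category_axioms F'a F'full F'faith cl_Hom[OF i] cl_Hom[OF p]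
    have "is_kernel S.D X Y Z (S.cl i) (S.cl p)"
      using full_faithful_reflects_kernel[OF r] kc(1) hom[OF i] hom[OF p] ob by simp
    moreover have "is_cokernel S.D X Y Z (S.cl i) (S.cl p)"
      using full_faithful_reflects_cokernel[OF r] kc(2) hom[OF i] hom[OF p] ob by simp
    ultimately show ?thesis unfolding kernel_cokernel_pair_def by blast
  qed
  then have rem: "removable A EA S"
    unfolding removable_def
    using S_add essential_kernel_projective[OF assms(1,2) pt] by (auto simp: S_def[symmetric])
  have F'E: "exact_functor S.D (factor_conflations A EA S) B EB F'"
    unfolding exact_functor_def
  proof (intro conjI F'a ballI, clarify)
    fix i p assume "(i, p) \<in> factor_conflations A EA S"
    then obtain i0 p0 where E: "(i0, p0) \<in> EA" and iso: "iso_pairs S.D (S.cl i0, S.cl p0) (i, p)"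
      unfolding factor_conflations_def by auto
    obtain X Y Z where i0: "i0 \<in> Hom A X Y" and p0: "p0 \<in> Hom A Y Z" using A.conflationE[OF E] .
    have "iso_pairs B (fhom F i0, fhom F p0) (fhom F' i, fhom F' p)"
      using functor_iso_pairs[OF F'f S.preadditive_factor iso] hom[OF i0] hom[OF p0] by simp
    then show "(fhom F' i, fhom F' p) \<in> EB" using B.conflation_iso[OF FE[OF E]] by blast
  qed
  have Gf: "is_functor B S.D G" using qi unfolding quasi_inverse_def by blast
  have GE: "exact_functor B EB S.D (factor_conflations A EA S) G"
    unfolding exact_functor_def
  proof (intro conjI ballI, goal_cases)
    case 1
    show ?case using quasi_inverse_additive[OF S.preadditive_factor B.preadditive_category_axioms qi F'a] .
  next
    case (2 e)
    obtain i p where e: "e = (i, p)" by (cases e)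
    obtain i0 p0 where E: "(i0, p0) \<in> EA" and iso: "iso_pairs B (fhom F i0, fhom F p0) (i, p)"
      using conflation_lift[OF assms(1,2) exact full dense proj] 2 e by metis
    obtain X Y Z where i0: "i0 \<in> Hom A X Y" and p0: "p0 \<in> Hom A Y Z" using A.conflationE[OF E] .
    \<comment> \<open>Applying \<open>G\<close> to the lifted conflation gives \<open>G F'\<close>
      of a pair of cosets, which is isomorphic to that pair itself; closure of
      \<open>factor_conflations\<close> under isomorphism does the rest.\<close>
    have "iso_pairs S.D (fhom G (fhom F' (S.cl i0)), fhom G (fhom F' (S.cl p0))) (fhom G i, fhom G p)"
      using functor_iso_pairs[OF Gf B.preadditive_category_axioms iso] hom[OF i0] hom[OF p0] by simp
    then have "iso_pairs S.D (S.cl i0, S.cl p0) (fhom G i, fhom G p)"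
      using D.iso_pairs_trans D.iso_pairs_sym
        quasi_inverse_iso_pairs[OF S.preadditive_factor qi cl_Hom[OF i0] cl_Hom[OF p0]] by blast
    then show ?case unfolding factor_conflations_def using E e by auto
  qed
  have "functor_eq A F (comp_functor F' (factor_functor A S))"
    unfolding functor_eq_def using hom ob by simp
  then show ?thesis
    unfolding frobenius_quotient_def exact_equivalence_def using Fa rem F'E GE qi by blast
qed

theorem theorem2p9:
  fixes A :: "('o1, 'm1) cat" and EA :: "('m1 \<times> 'm1) set"
    and B :: "('o2, 'm2) cat" and EB :: "('m2 \<times> 'm2) set"
    and F :: "('o1, 'm1, 'o2, 'm2) func"
  assumes "frobenius_category A EA" and "frobenius_category B EB"
    and "additive_functor A B F"
  shows "frobenius_quotient A EA B EB F \<longleftrightarrow>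
    pretriangle_equivalence A EA B EB F \<and> objective A B F \<and>
    full_functor A B F \<and> dense_functor A B F"
  using frobenius_quotientD[OF assms(1,2)] frobenius_quotientI[OF assms(1,2)] by blast

end
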